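(* For $n\ge 2$ let $h(n)$ denote the maximum size $m$ of an $(n,n)$-bounded 1-cross intersecting set pair system $(\mathcal{A},\mathcal{B})$ such that both $\mathcal{A}$ and $\mathcal{B}$ are 1-intersecting. Then $h(n)\ge \frac{1}{2}n^2-o(n^2)$ as $n\to\infty$.
   Context: A cross intersecting set pair system (SPS) of size $m\ge 2$ consists of finite sets $A_1,\dots,A_m$ and $B_1,\dots,B_m$ such that $A_i\cap B_i=\emptyset$ for every $1\le i\le m$ and $A_i\cap B_j\neq\emptyset$ for all $1\le i\neq j\le m$; one writes $\mathcal{A}=\{A_i\}_{i=1}^m$, $\mathcal{B}=\{B_i\}_{i=1}^m$. It is $(a,b)$-bounded if $|A_i|\le a$ and $|B_i|\le b$ for each $i$. It is 1-cross intersecting if $|A_i\cap B_j|=1$ for each $i\neq j$. $\mathcal{A}$ (resp. $\mathcal{B}$) is 1-intersecting if $|A_i\cap A_j|=1$ (resp. $|B_i\cap B_j|=1$) for all $i\ne j$. *)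

theory Defs
  imports Complex_Main "HOL-Library.Landau_Symbols"
begin

(* The families (A_1, ..., A_m) and (B_1, ..., B_m) are functions nat => 'a set of which
   only the values at the indices 1, ..., m matter. *)

definition cross_intersecting_sps :: "nat \<Rightarrow> (nat \<Rightarrow> 'a set) \<Rightarrow> (nat \<Rightarrow> 'a set) \<Rightarrow> bool" where
  "cross_intersecting_sps m A B \<longleftrightarrow>
     m \<ge> 2 \<and>
     (\<forall>i\<in>{1..m}. finite (A i) \<and> finite (B i)) \<and>
     (\<forall>i\<in>{1..m}. A i \<inter> B i = {}) \<and>
     (\<forall>i\<in>{1..m}. \<forall>j\<in>{1..m}. i \<noteq> j \<longrightarrow> A i \<inter> B j \<noteq> {})"

definition sps_bounded ::
    "nat \<Rightarrow> nat \<Rightarrow> nat \<Rightarrow> (nat \<Rightarrow> 'a set) \<Rightarrow> (nat \<Rightarrow> 'a set) \<Rightarrow> bool" where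
  "sps_bounded a b m A B \<longleftrightarrow> (\<forall>i\<in>{1..m}. card (A i) \<le> a \<and> card (B i) \<le> b)"

definition one_cross_intersecting ::
    "nat \<Rightarrow> (nat \<Rightarrow> 'a set) \<Rightarrow> (nat \<Rightarrow> 'a set) \<Rightarrow> bool" where
  "one_cross_intersecting m A B \<longleftrightarrow>
     (\<forall>i\<in>{1..m}. \<forall>j\<in>{1..m}. i \<noteq> j \<longrightarrow> card (A i \<inter> B j) = 1)"

definition one_intersecting :: "nat \<Rightarrow> (nat \<Rightarrow> 'a set) \<Rightarrow> bool" where
  "one_intersecting m A \<longleftrightarrow>
     (\<forall>i\<in>{1..m}. \<forall>j\<in>{1..m}. i \<noteq> j \<longrightarrow> card (A i \<inter> A j) = 1)"

(* Taking the sets to be sets of natural numbers is no restriction: a set pair system has a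
   finite union, which can be relabelled. The maximum exists for n >= 2: by Bollobas' theorem
   m is at most (2n choose n), and A = {0,1}, {0,2}; B = {2,3}, {1,3} has size 2. *)

definition h :: "nat \<Rightarrow> nat" where
  "h n = Max {m. \<exists>A B :: nat \<Rightarrow> nat set.
                   cross_intersecting_sps m A B \<and> sps_bounded n n m A B \<and>
                   one_cross_intersecting m A B \<and>
                   one_intersecting m A \<and> one_intersecting m B}"

end

theory Submission
  imports Defs "HOL-Complex_Analysis.Complex_Analysis" "HOL-Number_Theory.Cong"
begin

text \<open>
  A system of size \<open>k\<close> is the same as a list of \<open>2 * k\<close> sets, split into \<open>k\<close> consecutive pairs,
  in which partners are disjoint and all other pairs of sets share exactly one element: the
  \<open>A\<close>s are the first and the \<open>B\<close>s the second members of the pairs. The lines of the affine plane of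
  prime order \<open>p\<close> almost have this property. Two lines of different slope meet in one point, and
  parallel lines are disjoint; so it remains to make non-partners within each parallel class
  meet by adding new elements to the lines. For this any paired list \<open>T\<close> of at most \<open>p\<close> sets can
  be planted into every parallel class, using fresh elements for each slope
  (\<open>paired_family_line_step\<close>). If \<open>T\<close> were the list of stars of a complete graph without a perfect
  matching, its sets would have size about \<open>p\<close>, which is too much. But with a second, smaller prime
  \<open>r\<close>, planting the stars of size about \<open>r\<close> into the plane of order \<open>r\<close> gives \<open>r * (r - 1)\<close> sets of
  size less than \<open>2 * r\<close>, and planting \<open>p - 1\<close> of these into the plane of order \<open>p\<close> gives
  \<open>p * (p - 1)\<close> sets of size at most \<open>p + 2 * r\<close>. Hence \<open>h n \<ge> p * (p - 1) / 2\<close> as soon as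
  \<open>p + 2 * r \<le> n\<close> and \<open>p - 1 \<le> r * (r - 1)\<close> (\<open>h_ge_primes\<close>).

  For the asymptotic statement one needs a prime \<open>p\<close> between \<open>(1 - \<epsilon>) * n\<close> and \<open>n\<close> for all large \<open>n\<close>
  (\<open>primes_dense\<close>). This is slightly weaker than the prime number theorem and is proved by the
  method of Wiener and Ikehara. The function \<open>(s - 1) * \<zeta>(s)\<close> extends holomorphically to
  \<open>Re s > 0\<close>, and the inequality \<open>3 + 4 cos \<theta> + cos (2 \<theta>) \<ge> 0\<close> shows that it has no zeros with
  \<open>Re s \<ge> 1\<close>. Therefore the Dirichlet series with coefficients \<open>[n is prime] * ln n - 1\<close> extends
  continuously to the line \<open>Re s = 1\<close> (\<open>prime_series_boundary\<close>). Integrated over a segment of that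
  line against a triangular weight, it turns into a sum of these coefficients, divided by \<open>n\<close>,
  against a Fejer kernel centred at \<open>ln n = y\<close>; by the Riemann-Lebesgue lemma this sum tends to \<open>0\<close> as
  \<open>y\<close> grows. If there were no prime with \<open>\<bar>ln p - y\<bar> < \<epsilon>\<close>, the primes would only be seen by the tails of
  the kernel, which by Chebyshev's bound contribute \<open>O(1 / L)\<close> for a kernel of width \<open>1 / L\<close>,
  while the coefficients \<open>-1\<close> contribute a negative amount bounded away from \<open>0\<close>: a contradiction
  when \<open>L\<close> is large (\<open>primes_log_dense\<close>).
\<close>

section \<open>Paired families from affine lines\<close>

text \<open>The indices \<open>2 * i\<close> and \<open>2 * i + 1\<close> are partners. Keeping both members of a pair in one list turns
  the conditions on \<open>A\<close> against \<open>A\<close>, \<open>B\<close> against \<open>B\<close> and \<open>A\<close> against \<open>B\<close> into a single one.\<close>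
definition paired_family :: "nat \<Rightarrow> nat \<Rightarrow> (nat \<Rightarrow> 'a set) \<Rightarrow> bool" where
  "paired_family k t T \<longleftrightarrow>
     (\<forall>i<2*k. finite (T i) \<and> card (T i) \<le> t) \<and>
     (\<forall>i<2*k. \<forall>j<2*k. i \<noteq> j \<longrightarrow>
        card (T i \<inter> T j) = (if i div 2 = j div 2 then 0 else 1))"

lemma paired_family_mono:
  assumes "paired_family k t T" "k' \<le> k" "t \<le> t'"
  shows "paired_family k' t' T"
  using assms unfolding paired_family_def by (meson le_trans less_le_trans mult_le_mono2)

text \<open>Equating \<open>y = c * x + d\<close> and \<open>y = c' * x + d'\<close> gives a linear congruence whose coefficient
  \<open>c - c'\<close> is a unit modulo \<open>p\<close>.\<close>
lemma card_lines_meet: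
  fixes p c c' d d' :: nat
  assumes p: "prime p" and c: "c < p" "c' < p" "c \<noteq> c'"
  shows "card {x. x < p \<and> (x * c + d) mod p = (x * c' + d') mod p} = 1"
proof -
  have eq: "(x * c + d) mod p = (x * c' + d') mod p \<longleftrightarrow>
      [(int c - int c') * int x = int d' - int d] (mod int p)" for x :: nat
  proof -
    have "(x * c + d) mod p = (x * c' + d') mod p \<longleftrightarrow> [int (x * c + d) = int (x * c' + d')] (mod int p)"
      by (metis cong_def cong_int_iff)
    also have "\<dots> \<longleftrightarrow> int p dvd (int (x * c + d) - int (x * c' + d'))"
      by (rule cong_iff_dvd_diff)
    also have "int (x * c + d) - int (x * c' + d') = (int c - int c') * int x - (int d' - int d)"
      by (simp add: algebra_simps)
    also have "int p dvd \<dots> \<longleftrightarrow> [(int c - int c') * int x = int d' - int d] (mod int p)"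
      by (rule cong_iff_dvd_diff [symmetric])
    finally show ?thesis .
  qed
  have ndvd: "\<not> int p dvd (int c - int c')"
    using zdvd_not_zless[of "\<bar>int c - int c'\<bar>" "int p"] c by auto
  have cop: "coprime (int c - int c') (int p)"
    using p ndvd by (metis coprime_commute prime_imp_coprime prime_nat_int_transfer)
  then obtain a where a: "[(int c - int c') * a = 1] (mod int p)"
    using cong_solve_coprime_int by blast
  have p0: "p > 0" using p prime_gt_0_nat by blast
  define x where "x = nat ((a * (int d' - int d)) mod int p)"
  have xint: "int x = (a * (int d' - int d)) mod int p"
    using p0 by (simp add: x_def)
  have xp: "x < p" using p0 xint by (metis of_nat_0_less_iff of_nat_less_iff pos_mod_bound)
  have "[(int c - int c') * int x = (int c - int c') * (a * (int d' - int d))] (mod int p)"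
    unfolding xint by (simp add: cong_def mod_mult_right_eq)
  also have "(int c - int c') * (a * (int d' - int d)) = ((int c - int c') * a) * (int d' - int d)"
    by (simp add: mult.assoc)
  also have "[\<dots> = 1 * (int d' - int d)] (mod int p)"
    using a by (rule cong_mult) simp
  finally have sol: "[(int c - int c') * int x = int d' - int d] (mod int p)" by simp
  have "{x. x < p \<and> (x * c + d) mod p = (x * c' + d') mod p} = {x}"
  proof (intro equalityI subsetI; clarsimp simp: eq)
    fix z assume z: "z < p" "[(int c - int c') * int z = int d' - int d] (mod int p)"
    have "[(int c - int c') * int z = (int c - int c') * int x] (mod int p)"
      using z(2) sol by (meson cong_sym cong_trans)
    hence "[int z = int x] (mod int p)"
      using cop cong_mult_lcancel by blast
    thus "z = x" using z xp by (metis cong_int_iff cong_less_modulus_unique_nat)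
  qed (use xp sol in auto)
  thus ?thesis by simp
qed

text \<open>The index \<open>i\<close> encodes an affine line: its quotient by \<open>2 * k\<close> is the slope and its remainder the
  intercept, so that \<open>2 * k\<close> of the \<open>p\<close> parallel lines of each slope are used. The left summand is
  the point set of the line, the right one a copy of \<open>T\<close> that is private to the slope.\<close>
definition line_step :: "nat \<Rightarrow> nat \<Rightarrow> (nat \<Rightarrow> 'a set) \<Rightarrow> nat \<Rightarrow> (nat \<times> nat + nat \<times> 'a) set" where
  "line_step p k T i =
     Inl ` (\<lambda>x. (x, (x * (i div (2*k)) + i mod (2*k)) mod p)) ` {..<p} \<union>
     Inr ` ({i div (2*k)} \<times> T (i mod (2*k)))"

text \<open>Lines of different slopes meet in one point and have no elements of the copies of \<open>T\<close> in common;
  lines of the same slope are disjoint, so that \<open>T\<close> alone decides. As the blocks have even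
  length \<open>2 * k\<close>, partners never belong to different slopes.\<close>
lemma paired_family_line_step:
  assumes T: "paired_family k t T" and p: "prime p" "2 * k \<le> p"
  shows "paired_family (k * p) (p + t) (line_step p k T)"
proof (cases "k = 0")
  case True thus ?thesis by (simp add: paired_family_def)
next
  case False
  define sl where "sl i = i div (2*k)" for i
  define ic where "ic i = i mod (2*k)" for i
  define P where "P i = (\<lambda>x. (x, (x * sl i + ic i) mod p)) ` {..<p}" for i
  have ic: "ic i < 2*k" for i using False by (simp add: ic_def)
  have decomp: "i = sl i * (2*k) + ic i" for i
    unfolding sl_def ic_def by (rule div_mult_mod_eq [symmetric])
  have sl: "sl i < p" if "i < 2 * (k * p)" for i
    using that unfolding sl_def by (simp add: less_mult_imp_div_less mult.commute mult.left_commute)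
  have L: "line_step p k T i = Inl ` P i \<union> Inr ` ({sl i} \<times> T (ic i))" for i
    by (simp add: line_step_def P_def sl_def ic_def)
  have finT: "finite (T (ic i))" "card (T (ic i)) \<le> t" for i
    using T ic by (auto simp: paired_family_def)
  have finP: "finite (P i)" "card (P i) = p" for i
    by (auto simp: P_def card_image inj_on_def)
  have cardL: "finite (line_step p k T i) \<and> card (line_step p k T i) \<le> p + t" for i
  proof
    show "finite (line_step p k T i)" unfolding L using finT finP by auto
    have "card (line_step p k T i) \<le> card (Inl ` P i :: (nat \<times> nat + nat \<times> 'a) set)
        + card (Inr ` ({sl i} \<times> T (ic i)) :: (nat \<times> nat + nat \<times> 'a) set)"
      unfolding L by (rule card_Un_le)
    also have "\<dots> \<le> p + t"
      using finP[of i] finT[of i] by (simp add: card_image card_cartesian_product)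
    finally show "card (line_step p k T i) \<le> p + t" .
  qed
  have inter: "card (line_step p k T i \<inter> line_step p k T j) =
      card {x. x < p \<and> (x * sl i + ic i) mod p = (x * sl j + ic j) mod p} +
      (if sl i = sl j then card (T (ic i) \<inter> T (ic j)) else 0)" for i j
  proof -
    have "line_step p k T i \<inter> line_step p k T j =
        Inl ` (P i \<inter> P j) \<union> Inr ` (({sl i} \<inter> {sl j}) \<times> (T (ic i) \<inter> T (ic j)))"
      unfolding L by auto
    also have "card \<dots> = card (P i \<inter> P j) + card (({sl i} \<inter> {sl j}) \<times> (T (ic i) \<inter> T (ic j)))"
      by (subst card_Un_disjoint) (use finP finT in \<open>auto simp: card_image\<close>)
    also have "P i \<inter> P j = (\<lambda>x. (x, (x * sl i + ic i) mod p)) `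
        {x. x < p \<and> (x * sl i + ic i) mod p = (x * sl j + ic j) mod p}"
      unfolding P_def by auto
    also have "card \<dots> = card {x. x < p \<and> (x * sl i + ic i) mod p = (x * sl j + ic j) mod p}"
      by (rule card_image) (auto simp: inj_on_def)
    finally show ?thesis by (simp add: card_cartesian_product)
  qed
  have "card (line_step p k T i \<inter> line_step p k T j) = (if i div 2 = j div 2 then 0 else 1)"
    if ij: "i < 2 * (k * p)" "j < 2 * (k * p)" "i \<noteq> j" for i j
  proof -
    have hv: "i div 2 = sl i * k + ic i div 2" for i
      by (subst decomp) (simp add: mult.commute mult.left_commute)
    have ick: "ic i div 2 < k" for i using ic[of i] by linarith
    have dvi: "i div 2 div k = sl i" "i div 2 mod k = ic i div 2" for i
      using ick[of i] False by (simp_all add: hv[of i])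
    have half: "i div 2 = j div 2 \<longleftrightarrow> sl i = sl j \<and> ic i div 2 = ic j div 2"
      using dvi hv by metis
    show ?thesis
    proof (cases "sl i = sl j")
      case False
      thus ?thesis using card_lines_meet[OF p(1) sl[OF ij(1)] sl[OF ij(2)] False] inter half by simp
    next
      case True
      hence ne: "ic i \<noteq> ic j" using ij(3) decomp by metis
      have "{x. x < p \<and> (x * sl i + ic i) mod p = (x * sl j + ic j) mod p} = {}"
      proof -
        have "(x * sl i + ic i) mod p \<noteq> (x * sl i + ic j) mod p" for x
        proof
          assume "(x * sl i + ic i) mod p = (x * sl i + ic j) mod p"
          hence "[x * sl i + ic i = x * sl i + ic j] (mod p)" by (simp add: cong_def)
          hence "[ic i = ic j] (mod p)" by (simp add: cong_add_lcancel_nat)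
          thus False using ne ic[of i] ic[of j] p(2)
            by (meson cong_less_modulus_unique_nat less_le_trans)
        qed
        thus ?thesis using True by auto
      qed
      moreover have "card (T (ic i) \<inter> T (ic j)) = (if ic i div 2 = ic j div 2 then 0 else 1)"
        using T ne ic unfolding paired_family_def by blast
      ultimately show ?thesis using inter[of i j] half True by (simp only: card.empty) simp
    qed
  qed
  thus ?thesis using cardL unfolding paired_family_def by simp
qed

text \<open>The star of the vertex \<open>i\<close> in the graph that joins any two of \<open>2 * k\<close> vertices except partners.
  Ordering its end points makes an edge the same element in both of its stars.\<close>
definition edge_family :: "nat \<Rightarrow> nat \<Rightarrow> (nat \<times> nat) set" where
  "edge_family k i = (\<lambda>j. (min i j, max i j)) ` {j. j < 2 * k \<and> j div 2 \<noteq> i div 2}"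

lemma paired_family_edge_family: "paired_family k (2 * k) (edge_family k)"
proof -
  have "card (edge_family k i) \<le> 2 * k" for i
  proof -
    have "card (edge_family k i) \<le> card {j. j < 2 * k \<and> j div 2 \<noteq> i div 2}"
      unfolding edge_family_def by (rule card_image_le) simp
    also have "\<dots> \<le> card {..<2 * k}" by (rule card_mono) auto
    finally show ?thesis by simp
  qed
  moreover have "edge_family k i \<inter> edge_family k j = (if i div 2 = j div 2 then {} else {(min i j, max i j)})"
    if "i < 2 * k" "j < 2 * k" "i \<noteq> j" for i j
  proof -
    have "(min i j, max i j) \<in> edge_family k i" "(min i j, max i j) \<in> edge_family k j"
      if "i div 2 \<noteq> j div 2"
      using that \<open>i < 2*k\<close> \<open>j < 2*k\<close> unfolding edge_family_def
      by (auto intro!: image_eqI[of _ _ j] image_eqI[of _ _ i] simp: min.commute max.commute)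
    moreover have "z = (min i j, max i j) \<and> i div 2 \<noteq> j div 2"
      if "z \<in> edge_family k i" "z \<in> edge_family k j" for z
      using that \<open>i \<noteq> j\<close> unfolding edge_family_def
      by (auto simp: min_def max_def split: if_splits)
    ultimately show ?thesis by auto
  qed
  ultimately show ?thesis unfolding paired_family_def by (auto simp: edge_family_def)
qed

lemma paired_family_relabel:
  fixes T :: "nat \<Rightarrow> 'a::countable set"
  assumes "paired_family k t T"
  shows "paired_family k t (\<lambda>i. to_nat ` T i)"
proof -
  have "inj (to_nat :: 'a \<Rightarrow> nat)" by simp
  thus ?thesis using assms unfolding paired_family_def
    by (simp add: card_image inj_on_subset image_Int[symmetric])
qed


section \<open>From paired families to set pair systems\<close>

definition attainable_size :: "nat \<Rightarrow> nat \<Rightarrow> bool" where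
  "attainable_size n m \<longleftrightarrow> (\<exists>A B :: nat \<Rightarrow> nat set.
     cross_intersecting_sps m A B \<and> sps_bounded n n m A B \<and>
     one_cross_intersecting m A B \<and> one_intersecting m A \<and> one_intersecting m B)"

text \<open>This makes the maximum in the definition of \<open>h\<close> one over a finite set. Suppose that \<open>x\<close> lies
  in \<open>A l\<close>. The sets \<open>A j\<close> that contain \<open>x\<close> are pairwise disjoint apart from \<open>x\<close>, and \<open>B l\<close> avoids \<open>x\<close>
  but meets all of them except \<open>A l\<close>; so there are at most \<open>n + 1\<close> of them. The bound follows
  because every \<open>A j\<close> with \<open>j \<ge> 2\<close> contains one of the at most \<open>n\<close> elements of \<open>B 1\<close>.\<close>
lemma attainable_size_bound:
  assumes "attainable_size n m"
  shows "m \<le> n * (n + 1) + 1"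
proof -
  from assms obtain A B :: "nat \<Rightarrow> nat set" where
    S: "cross_intersecting_sps m A B" "sps_bounded n n m A B" "one_intersecting m A"
    unfolding attainable_size_def by blast
  have fin: "finite (A i)" "finite (B i)" if "i \<in> {1..m}" for i
    using S(1) that unfolding cross_intersecting_sps_def by auto
  have disj: "\<forall>i\<in>{1..m}. A i \<inter> B i = {}"
    using S(1) unfolding cross_intersecting_sps_def by (elim conjE)
  have cross: "\<forall>i\<in>{1..m}. \<forall>j\<in>{1..m}. i \<noteq> j \<longrightarrow> A i \<inter> B j \<noteq> {}"
    using S(1) unfolding cross_intersecting_sps_def by (elim conjE)
  have m: "m \<ge> 2" using S(1) unfolding cross_intersecting_sps_def by auto
  have deg: "card {j\<in>{2..m}. x \<in> A j} \<le> n + 1" for x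
  proof (cases "{j\<in>{2..m}. x \<in> A j} = {}")
    case False
    define J where "J = {j\<in>{2..m}. x \<in> A j}"
    from False obtain l where l: "l \<in> J" unfolding J_def by blast
    hence l': "l \<in> {1..m}" "x \<in> A l" by (auto simp: J_def)
    have "A l \<inter> B l = {}" using disj l'(1) by (rule bspec)
    hence xB: "x \<notin> B l" using l'(2) by auto
    have "\<exists>y. y \<in> A j \<inter> B l" if "j \<in> J - {l}" for j
    proof -
      have "j \<in> {1..m}" "j \<noteq> l" using that by (auto simp: J_def)
      hence "A j \<inter> B l \<noteq> {}" by (intro cross[rule_format] l'(1))
      thus ?thesis by auto
    qed
    then obtain f where f: "\<And>j. j \<in> J - {l} \<Longrightarrow> f j \<in> A j \<inter> B l" by metis
    have inj: "inj_on f (J - {l})"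
    proof
      fix i j assume ij: "i \<in> J - {l}" "j \<in> J - {l}" "f i = f j"
      show "i = j"
      proof (rule ccontr)
        assume "i \<noteq> j"
        hence c1: "card (A i \<inter> A j) = 1"
          using S(3) ij unfolding one_intersecting_def J_def by auto
        have "{x, f i} \<subseteq> A i \<inter> A j" using f[OF ij(1)] f[OF ij(2)] ij by (auto simp: J_def)
        moreover have "x \<noteq> f i" using f[OF ij(1)] xB by auto
        ultimately have "2 \<le> card (A i \<inter> A j)"
          by (metis c1 card.infinite card_2_iff card_mono zero_neq_one)
        thus False using c1 by simp
      qed
    qed
    have "card (J - {l}) \<le> card (B l)"
      by (rule card_inj_on_le[OF inj]) (use f fin l' in auto)
    also have "\<dots> \<le> n" using S(2) l' unfolding sps_bounded_def by auto
    finally have "card J \<le> n + 1" using l by simp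
    thus ?thesis by (simp add: J_def)
  next
    case True
    thus ?thesis by (simp only: card.empty)
  qed
  have "{2..m} \<subseteq> (\<Union>x\<in>B 1. {j\<in>{2..m}. x \<in> A j})"
  proof
    fix j assume j: "j \<in> {2..m}"
    hence "A j \<inter> B 1 \<noteq> {}" by (intro cross[rule_format]) auto
    thus "j \<in> (\<Union>x\<in>B 1. {j\<in>{2..m}. x \<in> A j})" using j by auto
  qed
  hence "card {2..m} \<le> card (\<Union>x\<in>B 1. {j\<in>{2..m}. x \<in> A j})"
    by (intro card_mono) (use fin[of 1] m in auto)
  also have "\<dots> \<le> (\<Sum>x\<in>B 1. card {j\<in>{2..m}. x \<in> A j})"
    by (rule card_UN_le) (use fin[of 1] m in auto)
  also have "\<dots> \<le> (\<Sum>x\<in>B 1. n + 1)" by (intro sum_mono deg)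
  also have "\<dots> = card (B 1) * (n + 1)" by simp
  also have "\<dots> \<le> n * (n + 1)"
    using S(2) m unfolding sps_bounded_def by (intro mult_right_mono) auto
  finally show ?thesis by simp
qed

lemma attainable_size_paired_family:
  fixes T :: "nat \<Rightarrow> nat set"
  assumes T: "paired_family k n T" and k: "k \<ge> 2"
  shows "attainable_size n k"
proof -
  define A where "A i = T (2 * (i - 1))" for i
  define B where "B i = T (2 * (i - 1) + 1)" for i
  have fc: "finite (T i) \<and> card (T i) \<le> n" if "i < 2 * k" for i
    using T that unfolding paired_family_def by auto
  have ic: "card (T i \<inter> T j) = (if i div 2 = j div 2 then 0 else 1)"
    if "i < 2 * k" "j < 2 * k" "i \<noteq> j" for i j
    using T that unfolding paired_family_def by auto
  have A: "finite (A i)" "card (A i) \<le> n" and B: "finite (B i)" "card (B i) \<le> n"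
    if "i \<in> {1..k}" for i using that unfolding A_def B_def by (auto intro!: fc conjunct1[OF fc] conjunct2[OF fc])
  have AB0: "A i \<inter> B i = {}" if "i \<in> {1..k}" for i
  proof -
    have "card (A i \<inter> B i) = 0" using that unfolding A_def B_def by (subst ic) auto
    thus ?thesis using A[OF that] by simp
  qed
  have AB: "card (A i \<inter> B j) = 1" "card (A i \<inter> A j) = 1" "card (B i \<inter> B j) = 1"
    if "i \<in> {1..k}" "j \<in> {1..k}" "i \<noteq> j" for i j
    using that unfolding A_def B_def by (subst ic; auto)+
  have "A i \<inter> B j \<noteq> {}" if "i \<in> {1..k}" "j \<in> {1..k}" "i \<noteq> j" for i j
    using AB(1)[OF that] by auto
  hence "cross_intersecting_sps k A B" "sps_bounded n n k A B" "one_cross_intersecting k A B"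
      "one_intersecting k A" "one_intersecting k B"
    using k A B AB0 AB unfolding cross_intersecting_sps_def sps_bounded_def
      one_cross_intersecting_def one_intersecting_def by auto
  thus ?thesis unfolding attainable_size_def by blast
qed

lemma h_ge:
  assumes "attainable_size n m"
  shows "m \<le> h n"
proof -
  have h: "h n = Max {m. attainable_size n m}" by (simp add: h_def attainable_size_def)
  have "finite {m. attainable_size n m}"
    by (rule finite_subset[of _ "{..n * (n + 1) + 1}"]) (use attainable_size_bound in auto)
  thus ?thesis unfolding h using assms by (intro Max_ge) auto
qed

text \<open>The stars on \<open>r - 1\<close> vertices are planted into the plane of order \<open>r\<close>, and \<open>p - 1\<close> of the resulting
  sets into the plane of order \<open>p\<close>. Both primes are odd, so \<open>r - 1\<close> and \<open>p - 1\<close> sets fall into pairs.\<close>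
lemma h_ge_primes:
  assumes p: "prime p" "p > 2" and r: "prime r" "r > 2" "p - 1 \<le> r * (r - 1)"
    and n: "p + 2 * r \<le> n"
  shows "(p - 1) div 2 * p \<le> h n"
proof -
  have ev: "2 * ((p - 1) div 2) = p - 1" "2 * ((r - 1) div 2) = r - 1"
    using prime_odd_nat[OF p] prime_odd_nat[OF r(1,2)] by auto
  define k0 where "k0 = (r - 1) div 2"
  define k1 where "k1 = (p - 1) div 2"
  have "paired_family (k0 * r) (r + 2 * k0) (line_step r k0 (edge_family k0))"
    by (intro paired_family_line_step paired_family_edge_family r) (simp add: k0_def)
  moreover have "k1 \<le> k0 * r"
  proof -
    have "2 * k1 \<le> 2 * (k0 * r)" using r(3) ev unfolding k0_def k1_def
      by (metis mult.commute mult.left_commute)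
    thus ?thesis by simp
  qed
  ultimately have "paired_family k1 (2 * r) (line_step r k0 (edge_family k0))"
    by (rule paired_family_mono) (simp add: k0_def)
  hence "paired_family (k1 * p) (p + 2 * r) (line_step p k1 (line_step r k0 (edge_family k0)))"
    by (rule paired_family_line_step[OF _ p(1)]) (simp add: k1_def)
  hence "paired_family (k1 * p) n (\<lambda>i. to_nat ` line_step p k1 (line_step r k0 (edge_family k0)) i)"
    by (intro paired_family_relabel) (use n in \<open>auto intro: paired_family_mono\<close>)
  moreover have "k1 * p \<ge> 2"
  proof -
    have "k1 \<ge> 1" using p unfolding k1_def by auto
    thus ?thesis using p mult_le_mono[of 1 k1 2 p] by simp
  qed
  ultimately show ?thesis unfolding k1_def[symmetric]
    by (intro h_ge attainable_size_paired_family)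
qed

section \<open>The zeta function to the right of the imaginary axis\<close>

text \<open>All series below run over all natural numbers. Since \<open>0 powr z = 0\<close>, the index \<open>0\<close> contributes
  nothing to a Dirichlet series.\<close>
abbreviation inv_pow :: "nat \<Rightarrow> complex \<Rightarrow> complex" where
  "inv_pow n s \<equiv> of_nat n powr (- s)"

lemma norm_inv_pow: "norm (inv_pow n s) = real n powr (- Re s)"
  by (simp add: norm_powr_real_powr)

lemma has_field_derivative_inv_pow:
  "((\<lambda>s. inv_pow n s) has_field_derivative (- of_real (ln (real n)) * inv_pow n s)) (at s)"
proof (cases "n = 0")
  case False
  have Ln: "Ln (of_nat n) = of_real (ln (real n))" using False by (simp flip: Ln_of_nat)
  have "((\<lambda>s. inv_pow n s) has_field_derivative (Ln (of_nat n) * inv_pow n s * (-1))) (at s)"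
  proof (rule DERIV_chain2[where f = "\<lambda>z. of_nat n powr z" and g = "\<lambda>s. - s"])
    show "((\<lambda>z. of_nat n powr z) has_field_derivative Ln (of_nat n) * inv_pow n s) (at (- s))"
      using False by (intro has_field_derivative_powr_right) simp
    show "(uminus has_field_derivative - 1) (at s)"
      by (rule DERIV_minus [OF DERIV_ident])
  qed
  thus ?thesis using Ln by simp
qed simp

lemma summable_inv_pow:
  assumes "Re s > 1"
  shows "summable (\<lambda>n. norm (inv_pow n s))" "summable (\<lambda>n. inv_pow n s)"
proof -
  show "summable (\<lambda>n. norm (inv_pow n s))"
    unfolding norm_inv_pow using assms by (simp add: summable_real_powr_iff)
  thus "summable (\<lambda>n. inv_pow n s)" by (rule summable_norm_cancel)
qed

lemma summable_ln_powr:
  fixes a :: real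
  assumes "a > 1"
  shows "summable (\<lambda>n. ln (real n) * real n powr (- a))"
proof (rule summable_comparison_test)
  define b where "b = (a - 1) / 2"
  have b: "b > 0" using assms by (simp add: b_def)
  show "\<exists>N. \<forall>n\<ge>N. norm (ln (real n) * real n powr (- a)) \<le> real n powr (b - a) / b"
  proof (intro exI allI impI)
    fix n :: nat assume n: "n \<ge> 1"
    have "ln (real n) \<le> real n powr b / b" using n b by (intro ln_powr_bound) auto
    hence "ln (real n) * real n powr (- a) \<le> (real n powr b / b) * real n powr (- a)"
      by (intro mult_right_mono) auto
    also have "\<dots> = real n powr (b - a) / b" using n by (simp add: powr_diff powr_minus field_simps)
    finally show "norm (ln (real n) * real n powr (- a)) \<le> real n powr (b - a) / b"
      using n by simp
  qed
  show "summable (\<lambda>n. real n powr (b - a) / b)"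
    using assms by (intro summable_divide) (simp add: summable_real_powr_iff b_def field_simps)
qed

definition zeta_series :: "complex \<Rightarrow> complex" where
  "zeta_series s = (\<Sum>n. inv_pow n s)"

lemma has_field_derivative_zeta_series:
  assumes s: "Re s > 1"
  shows "(zeta_series has_field_derivative - (\<Sum>n. of_real (ln (real n)) * inv_pow n s)) (at s)"
    and "summable (\<lambda>n. norm (of_real (ln (real n)) * inv_pow n s))"
proof -
  show sm: "summable (\<lambda>n. norm (of_real (ln (real n)) * inv_pow n s))"
  proof -
    have "norm (of_real (ln (real n)) * inv_pow n s) = ln (real n) * real n powr (- Re s)" for n
      by (cases "n = 0") (simp_all add: norm_mult norm_inv_pow)
    thus ?thesis using summable_ln_powr[OF s] by simp
  qed
  define S where "S = {s::complex. Re s > 1}"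
  have "open S" unfolding S_def by (rule open_halfspace_Re_gt)
  moreover have "\<exists>d h. 0 < d \<and> summable h \<and> (\<forall>\<^sub>F n in sequentially. \<forall>y\<in>ball x d \<inter> S. norm (inv_pow n y) \<le> h n)"
    if "x \<in> S" for x
  proof -
    define d where "d = (Re x - 1) / 2"
    have d: "d > 0" "Re x - d > 1" using that by (auto simp: d_def S_def field_simps)
    have "norm (inv_pow n y) \<le> real n powr (- (Re x - d))" if "n > 0" "y \<in> ball x d \<inter> S" for n y
    proof -
      have "\<bar>Re x - Re y\<bar> < d" using that abs_Re_le_cmod[of "x - y"] by (auto simp: dist_norm)
      thus ?thesis unfolding norm_inv_pow using that by (intro powr_mono) auto
    qed
    hence "\<forall>\<^sub>F n in sequentially. \<forall>y\<in>ball x d \<inter> S. norm (inv_pow n y) \<le> real n powr (- (Re x - d))"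
      by (intro eventually_mono[OF eventually_gt_at_top[of 0]]) auto
    moreover have "summable (\<lambda>n. real n powr (- (Re x - d)))"
      using d by (simp add: summable_real_powr_iff)
    ultimately show ?thesis using d by blast
  qed
  ultimately have "\<exists>g g'. \<forall>x\<in>S. (\<lambda>n. inv_pow n x) sums g x \<and>
      (\<lambda>n. - of_real (ln (real n)) * inv_pow n x) sums g' x \<and> (g has_field_derivative g' x) (at x)"
    using has_field_derivative_inv_pow by (intro series_and_derivative_comparison_local)
  then obtain g g' where g: "\<And>x. x \<in> S \<Longrightarrow> (\<lambda>n. inv_pow n x) sums g x"
      "\<And>x. x \<in> S \<Longrightarrow> (\<lambda>n. - of_real (ln (real n)) * inv_pow n x) sums g' x"
      "\<And>x. x \<in> S \<Longrightarrow> (g has_field_derivative g' x) (at x)"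
    by blast
  have sS: "s \<in> S" using s by (simp add: S_def)
  have "(zeta_series has_field_derivative g' s) (at s)"
    by (rule has_field_derivative_transform_within_open[OF g(3)[OF sS] \<open>open S\<close> sS])
       (use g(1) in \<open>auto simp: zeta_series_def sums_iff\<close>)
  moreover have "g' s = - (\<Sum>n. of_real (ln (real n)) * inv_pow n s)"
    using g(2)[OF sS] suminf_minus[OF summable_norm_cancel[OF sm]] by (simp add: sums_iff)
  ultimately show "(zeta_series has_field_derivative - (\<Sum>n. of_real (ln (real n)) * inv_pow n s)) (at s)"
    by simp
qed

text \<open>This is \<open>s - 1\<close> times the difference between \<open>n powr (- s)\<close> and the integral of \<open>x powr (- s)\<close> from \<open>n\<close>
  to \<open>n + 1\<close>, written so that it is an entire function of \<open>s\<close>. The last two summands telescope, so the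
  series represents \<open>(s - 1) * \<zeta>(s)\<close> where \<open>Re s > 1\<close>, but it still converges where \<open>Re s > 0\<close>. Because
  \<open>0 powr z = 0\<close>, the term with \<open>n = 0\<close> is the constant \<open>1\<close> left over by the telescoping sum.\<close>
definition zeta_pole_term :: "nat \<Rightarrow> complex \<Rightarrow> complex" where
  "zeta_pole_term n s = (s - 1) * inv_pow n s + of_nat (Suc n) powr (1 - s) - of_nat n powr (1 - s)"

definition zeta_times_pole :: "complex \<Rightarrow> complex" where
  "zeta_times_pole s = (\<Sum>n. zeta_pole_term n s)"

text \<open>The term is the remainder of the first-order Taylor expansion of \<open>x powr (1 - s)\<close> at \<open>x = n\<close>.\<close>
lemma norm_zeta_pole_term_le:
  assumes n: "n > 0" and s: "Re s > 0"
  shows "norm (zeta_pole_term n s) \<le> norm s * norm (s - 1) * real n powr (- Re s - 1)"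
proof -
  define S where "S = closed_segment (of_nat n :: complex) (of_nat (Suc n))"
  have S: "\<exists>r. x = of_real r \<and> r \<ge> real n" if "x \<in> S" for x
  proof -
    have "x \<in> closed_segment (of_real (real n) :: complex) (of_real (real (Suc n)))"
      using that by (simp add: S_def)
    thus ?thesis unfolding closed_segment_of_real by (auto simp: closed_segment_eq_real_ivl)
  qed
  define f :: "nat \<Rightarrow> complex \<Rightarrow> complex" where
    "f i x = (if i = 0 then x powr (1 - s) else if i = 1 then (1 - s) * x powr (- s)
              else (1 - s) * (- s) * x powr (- s - 1))" for i x
  have "norm (f 0 (of_nat (Suc n)) - (\<Sum>i\<le>1. f i (of_nat n) * (of_nat (Suc n) - of_nat n) ^ i / (fact i)))
      \<le> (norm s * norm (s - 1) * real n powr (- Re s - 1)) * norm (of_nat (Suc n) - of_nat n :: complex) ^ (Suc 1) / fact 1"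
  proof (rule field_Taylor[of S])
    show "convex S" "of_nat n \<in> S" "of_nat (Suc n) \<in> S" by (auto simp: S_def)
    fix x assume "x \<in> S"
    then obtain r where r: "x = of_real r" "r \<ge> real n" using S by blast
    have r0: "r > 0" using r n by linarith
    hence nn: "x \<notin> \<real>\<^sub>\<le>\<^sub>0" "x \<noteq> 0" using r by auto
    show "norm (f (Suc 1) x) \<le> norm s * norm (s - 1) * real n powr (- Re s - 1)"
    proof -
      have "norm (f (Suc 1) x) = norm s * norm (s - 1) * r powr (- Re s - 1)"
        using r r0 by (simp add: f_def norm_mult norm_minus_commute norm_powr_real_powr)
      also have "\<dots> \<le> norm s * norm (s - 1) * real n powr (- Re s - 1)"
        using r n s by (intro mult_left_mono powr_mono2') auto
      finally show ?thesis .
    qed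
    fix i :: nat assume "i \<le> 1"
    hence "i = 0 \<or> i = 1" by auto
    thus "(f i has_field_derivative f (Suc i) x) (at x within S)"
    proof
      assume i: "i = 0"
      have "((\<lambda>x. x powr (1 - s)) has_field_derivative (1 - s) * x powr (- s)) (at x)"
        using nn by (auto intro!: derivative_eq_intros)
      thus ?thesis using i by (simp add: f_def [abs_def] has_field_derivative_at_within)
    next
      assume i: "i = 1"
      have "((\<lambda>x. (1 - s) * x powr (- s)) has_field_derivative (1 - s) * (- s) * x powr (- s - 1)) (at x)"
        using nn by (auto intro!: derivative_eq_intros)
      thus ?thesis using i by (simp add: f_def [abs_def] has_field_derivative_at_within)
    qed
  qed
  thus ?thesis by (simp add: f_def zeta_pole_term_def algebra_simps)
qed

lemma holomorphic_zeta_times_pole: "zeta_times_pole holomorphic_on {s. Re s > 0}"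
proof (rule holomorphic_uniform_sequence)
  show op: "open {s. Re s > 0}" by (rule open_halfspace_Re_gt)
  show "(\<lambda>s. \<Sum>i<n. zeta_pole_term i s) holomorphic_on {s. 0 < Re s}" for n
  proof (intro holomorphic_intros)
    fix i
    have "(\<lambda>s. (of_nat k :: complex) powr g s) holomorphic_on {s. 0 < Re s}"
      if "g holomorphic_on {s. 0 < Re s}" for k and g :: "complex \<Rightarrow> complex"
      using that by (cases "k = 0") (auto intro!: holomorphic_intros)
    thus "zeta_pole_term i holomorphic_on {s. 0 < Re s}"
      unfolding zeta_pole_term_def [abs_def] by (intro holomorphic_intros)
  qed
  fix x :: complex assume x: "x \<in> {s. 0 < Re s}"
  define d where "d = Re x / 2"
  define C where "C = (norm x + d) * (norm x + d + 1)"
  have d: "d > 0" using x by (simp add: d_def)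
  have yb: "Re y \<ge> d" "norm y \<le> norm x + d" if "y \<in> cball x d" for y
  proof -
    show "Re y \<ge> d" using that abs_Re_le_cmod[of "x - y"] by (auto simp: dist_norm d_def)
    show "norm y \<le> norm x + d" using that norm_triangle_sub[of y x] by (auto simp: dist_norm norm_minus_commute)
  qed
  have "uniform_limit (cball x d) (\<lambda>n s. \<Sum>i<n. zeta_pole_term i s) (\<lambda>s. \<Sum>i. zeta_pole_term i s) sequentially"
  proof (rule Weierstrass_m_test_ev)
    show "\<forall>\<^sub>F n in sequentially. \<forall>y\<in>cball x d. norm (zeta_pole_term n y) \<le> C * real n powr (- d - 1)"
    proof (intro eventually_mono[OF eventually_gt_at_top[of 0]] ballI)
      fix n :: nat and y assume n: "n > 0" and y: "y \<in> cball x d"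
      have "norm (zeta_pole_term n y) \<le> norm y * norm (y - 1) * real n powr (- Re y - 1)"
        using norm_zeta_pole_term_le[OF n] yb[OF y] d by simp
      also have "\<dots> \<le> C * real n powr (- d - 1)"
        unfolding C_def using yb[OF y] n d norm_triangle_ineq4[of y 1]
        by (intro mult_mono powr_mono) auto
      finally show "norm (zeta_pole_term n y) \<le> C * real n powr (- d - 1)" .
    qed
    show "summable (\<lambda>n. C * real n powr (- d - 1))"
      using d by (intro summable_mult) (simp add: summable_real_powr_iff)
  qed
  moreover have "cball x d \<subseteq> {s. 0 < Re s}" using yb d by force
  ultimately show "\<exists>d>0. cball x d \<subseteq> {s. 0 < Re s} \<and>
      uniform_limit (cball x d) (\<lambda>n s. \<Sum>i<n. zeta_pole_term i s) zeta_times_pole sequentially"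
    using d unfolding zeta_times_pole_def [abs_def] by blast
qed

lemma zeta_times_pole_eq:
  assumes s: "Re s > 1"
  shows "zeta_times_pole s = (s - 1) * zeta_series s"
proof -
  have part: "(\<Sum>i<n. zeta_pole_term i s) = (s - 1) * (\<Sum>i<n. inv_pow i s) + of_nat n powr (1 - s)" for n
  proof (induction n)
    case (Suc n)
    have "(\<Sum>i<Suc n. zeta_pole_term i s) = (\<Sum>i<n. zeta_pole_term i s) + zeta_pole_term n s" by simp
    also note Suc
    finally show ?case unfolding zeta_pole_term_def sum.lessThan_Suc distrib_left by simp
  qed simp
  have "(\<lambda>n. of_nat n powr (1 - s)) \<longlonglongrightarrow> (0 :: complex)"
  proof (rule tendsto_norm_zero_cancel)
    have "(\<lambda>n. real n powr (- (Re s - 1))) \<longlonglongrightarrow> 0"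
      using s by (intro tendsto_neg_powr filterlim_real_sequentially) auto
    thus "(\<lambda>n. norm (of_nat n powr (1 - s) :: complex)) \<longlonglongrightarrow> 0"
      by (simp add: norm_powr_real_powr)
  qed
  moreover have "(\<lambda>n. \<Sum>i<n. inv_pow i s) \<longlonglongrightarrow> zeta_series s"
    unfolding zeta_series_def using summable_inv_pow(2)[OF s] by (rule summable_LIMSEQ)
  ultimately have "(\<lambda>n. (s - 1) * (\<Sum>i<n. inv_pow i s) + of_nat n powr (1 - s)) \<longlonglongrightarrow> (s - 1) * zeta_series s + 0"
    by (intro tendsto_intros)
  hence "(\<lambda>n. zeta_pole_term n s) sums ((s - 1) * zeta_series s)"
    unfolding sums_def part by simp
  thus ?thesis unfolding zeta_times_pole_def by (simp add: sums_iff)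
qed

lemma zeta_times_pole_1: "zeta_times_pole 1 = 1"
proof -
  have nz: "1 + complex_of_nat n \<noteq> 0" for n
    by (metis of_nat_Suc of_nat_eq_0_iff nat.distinct(1))
  have "zeta_pole_term n 1 = (if n = 0 then 1 else 0)" for n by (simp add: zeta_pole_term_def nz)
  thus ?thesis unfolding zeta_times_pole_def by (simp add: sums_unique[OF sums_single, symmetric])
qed

section \<open>The logarithmic derivative of zeta and the primes\<close>

definition prime_ln :: "nat \<Rightarrow> real" where
  "prime_ln n = (if prime n then ln (real n) else 0)"

lemma prime_ln_nonneg: "prime_ln n \<ge> 0"
  by (auto simp: prime_ln_def intro!: ln_ge_zero dest: prime_ge_1_nat)

lemma prime_ln_le: "prime_ln n \<le> ln (real n)"
  by (cases "n = 0") (auto simp: prime_ln_def)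

definition prime_series :: "complex \<Rightarrow> complex" where
  "prime_series s = (\<Sum>n. of_real (prime_ln n) * inv_pow n s)"

text \<open>The primes enter \<open>- \<zeta>' / \<zeta>\<close> through \<open>ln p / (p powr s - 1)\<close>. Splitting off the main
  term \<open>ln p * p powr (- s)\<close> leaves these terms, whose series is harmless on \<open>Re s \<ge> 1\<close>.\<close>
definition remainder_term :: "nat \<Rightarrow> complex \<Rightarrow> complex" where
  "remainder_term n s = of_real (prime_ln n) * inv_pow n s / (of_nat n powr s - 1)"

definition prime_remainder :: "complex \<Rightarrow> complex" where
  "prime_remainder s = (\<Sum>n. remainder_term n s)"

lemma summable_prime_series:
  assumes "Re s > 1"
  shows "summable (\<lambda>n. norm (of_real (prime_ln n) * inv_pow n s))"
proof (rule summable_comparison_test)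
  show "summable (\<lambda>n. ln (real n) * real n powr (- Re s))" by (rule summable_ln_powr[OF assms])
  show "\<exists>N. \<forall>n\<ge>N. norm (norm (of_real (prime_ln n) * inv_pow n s)) \<le> ln (real n) * real n powr (- Re s)"
    by (intro exI[of _ 0] allI impI)
       (simp add: norm_mult norm_inv_pow prime_ln_nonneg prime_ln_le mult_right_mono)
qed

lemma norm_powr_minus_1_ge:
  assumes n: "n \<ge> 2" and s: "Re s \<ge> 1"
  shows "norm (of_nat n powr s - 1) \<ge> real n / 2"
proof -
  have "real n powr 1 \<le> real n powr (Re s)" using n s by (intro powr_mono) auto
  hence "real n \<le> norm (of_nat n powr s)" using n by (simp add: norm_powr_real_powr)
  also have "\<dots> \<le> norm (of_nat n powr s - 1) + 1"
    using norm_triangle_sub[of "of_nat n powr s" "1::complex"] by simp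
  finally show ?thesis using n by simp
qed

lemma norm_remainder_term_le:
  assumes s: "Re s \<ge> 1"
  shows "norm (remainder_term n s) \<le> 2 * (ln (real n) * real n powr (- 2))"
proof (cases "prime n")
  case True
  hence n: "n \<ge> 2" by (rule prime_ge_2_nat)
  have "norm (remainder_term n s) = ln (real n) * real n powr (- Re s) / norm (of_nat n powr s - 1)"
    using True n by (simp add: remainder_term_def prime_ln_def norm_mult norm_divide norm_inv_pow)
  also have "\<dots> \<le> ln (real n) * real n powr (- 1) / (real n / 2)"
    using norm_powr_minus_1_ge[OF n s] n s
    by (intro frac_le mult_left_mono powr_mono mult_nonneg_nonneg) auto
  also have "real n powr (- 2) = real n powr (- 1) / real n"
    using n powr_diff[of "real n" "-1" 1] by simp
  hence "ln (real n) * real n powr (- 1) / (real n / 2) = 2 * (ln (real n) * real n powr (- 2))"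
    by simp
  finally show ?thesis .
next
  case False
  have "0 \<le> ln (real n)" by (cases "n = 0") auto
  thus ?thesis using False by (simp add: remainder_term_def prime_ln_def)
qed

lemma summable_remainder_term_bound: "summable (\<lambda>n. 2 * (ln (real n) * real n powr (- 2)))"
  by (intro summable_mult summable_ln_powr) simp

lemma summable_remainder_term:
  assumes "Re s \<ge> 1" shows "summable (\<lambda>n. norm (remainder_term n s))"
  by (rule summable_comparison_test[OF _ summable_remainder_term_bound])
     (use norm_remainder_term_le[OF assms] in auto)

lemma norm_prime_remainder_le:
  assumes "Re s \<ge> 1" shows "norm (prime_remainder s) \<le> (\<Sum>n. 2 * (ln (real n) * real n powr (- 2)))"
  unfolding prime_remainder_def using norm_remainder_term_le[OF assms] summable_remainder_term_bound by (rule norm_suminf_le)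

lemma continuous_prime_remainder: "continuous_on {s. Re s \<ge> 1} prime_remainder"
proof -
  have "uniform_limit {s. Re s \<ge> 1} (\<lambda>n s. \<Sum>i<n. remainder_term i s) (\<lambda>s. \<Sum>i. remainder_term i s) sequentially"
    by (rule Weierstrass_m_test[OF _ summable_remainder_term_bound]) (use norm_remainder_term_le in auto)
  moreover have "continuous_on {s. Re s \<ge> 1} (remainder_term i)" for i
  proof (cases "prime i")
    case True
    hence i: "i \<ge> 2" by (rule prime_ge_2_nat)
    have "of_nat i powr s - 1 \<noteq> (0 :: complex)" if "Re s \<ge> 1" for s
      using norm_powr_minus_1_ge[OF i that] i by (auto simp del: norm_eq_zero)
    thus ?thesis unfolding remainder_term_def [abs_def] using i by (intro continuous_intros) auto
  next
    case False
    thus ?thesis by (simp add: remainder_term_def [abs_def] prime_ln_def)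
  qed
  ultimately have "continuous_on {s. Re s \<ge> 1} (\<lambda>s. \<Sum>i. remainder_term i s)"
    by (intro uniform_limit_theorem[where F = sequentially]) (auto intro!: always_eventually continuous_on_sum)
  thus ?thesis by (simp add: prime_remainder_def [abs_def])
qed

lemma multiplicity_ln_le:
  assumes p: "prime p"
  shows "real (multiplicity p n) * ln (real p) \<le> ln (real n)"
proof (cases "n = 0")
  case False
  have "p ^ multiplicity p n \<le> n" using False by (intro dvd_imp_le multiplicity_dvd) auto
  hence "real p ^ multiplicity p n \<le> real n" by (metis of_nat_le_iff of_nat_power)
  hence "ln (real p ^ multiplicity p n) \<le> ln (real n)"
    using p prime_gt_0_nat[of p] False by (subst ln_le_cancel_iff) auto
  thus ?thesis using p prime_gt_0_nat[of p] by (simp add: ln_realpow)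
qed simp

text \<open>Only multiples of \<open>p\<close> contribute, and multiplying \<open>n\<close> by \<open>p\<close> raises the multiplicity by one. Hence the sum
  \<open>V\<close> satisfies \<open>V = p powr (- s) * (\<zeta>(s) + V)\<close>.\<close>
lemma multiplicity_series:
  assumes p: "prime p" and s: "Re s > 1"
  shows "(\<lambda>n. of_nat (multiplicity p n) * inv_pow n s) sums (zeta_series s / (of_nat p powr s - 1))"
    and "summable (\<lambda>n. norm (of_nat (multiplicity p n) * inv_pow n s))"
proof -
  define f where "f n = of_nat (multiplicity p n) * inv_pow n s" for n
  have p2: "p \<ge> 2" using p by (rule prime_ge_2_nat)
  have lnp: "ln (real p) > 0" using p2 by simp
  show smn: "summable (\<lambda>n. norm (of_nat (multiplicity p n) * inv_pow n s))"
  proof (rule summable_comparison_test)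
    show "summable (\<lambda>n. ln (real n) * real n powr (- Re s) / ln (real p))"
      by (intro summable_divide summable_ln_powr s)
    show "\<exists>N. \<forall>n\<ge>N. norm (norm (of_nat (multiplicity p n) * inv_pow n s)) \<le> ln (real n) * real n powr (- Re s) / ln (real p)"
    proof (intro exI[of _ 0] allI impI)
      fix n
      have "real (multiplicity p n) * ln (real p) * real n powr (- Re s) \<le> ln (real n) * real n powr (- Re s)"
        by (intro mult_right_mono multiplicity_ln_le p) auto
      thus "norm (norm (of_nat (multiplicity p n) * inv_pow n s)) \<le> ln (real n) * real n powr (- Re s) / ln (real p)"
        using lnp by (simp add: norm_mult norm_inv_pow field_simps)
    qed
  qed
  hence "summable f" unfolding f_def by (rule summable_norm_cancel)
  hence sf: "f sums suminf f" by (rule summable_sums)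
  have mono: "strict_mono (\<lambda>m. p * m)" using p2 by (intro strict_monoI) simp
  have zero: "f n = 0" if "n \<notin> range (\<lambda>m. p * m)" for n
  proof -
    have "\<not> p dvd n" using that by auto
    thus "f n = 0" by (simp add: f_def not_dvd_imp_multiplicity_0)
  qed
  have "(\<lambda>m. f (p * m)) sums suminf f"
    using sums_mono_reindex[of "\<lambda>m. p * m" f "suminf f", OF mono zero] sf by simp
  moreover have "f (p * m) = inv_pow p s * (inv_pow m s + f m)" for m
  proof (cases "m = 0")
    case False
    have "multiplicity p (p * m) = Suc (multiplicity p m)"
      using p False by (intro multiplicity_times_same) (auto simp: prime_gt_1_nat)
    moreover have "inv_pow (p * m) s = inv_pow p s * inv_pow m s"
      by (simp add: powr_times_real)
    ultimately show ?thesis by (simp add: f_def algebra_simps)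
  qed (simp add: f_def)
  ultimately have "(\<lambda>m. inv_pow p s * (inv_pow m s + f m)) sums suminf f" by simp
  moreover have "(\<lambda>m. inv_pow p s * (inv_pow m s + f m)) sums (inv_pow p s * (zeta_series s + suminf f))"
    unfolding zeta_series_def using summable_inv_pow(2)[OF s] by (intro sums_mult sums_add sf summable_sums)
  ultimately have eq: "suminf f = inv_pow p s * (zeta_series s + suminf f)" by (rule sums_unique2)
  have "of_nat p powr s \<noteq> (0::complex)" using p2 by simp
  hence "of_nat p powr s * inv_pow p s = 1" by (simp add: powr_minus)
  moreover have "of_nat p powr s * suminf f = of_nat p powr s * (inv_pow p s * (zeta_series s + suminf f))"
    by (simp only: eq [symmetric])
  ultimately have "of_nat p powr s * suminf f = zeta_series s + suminf f"
    by (simp only: mult.assoc [symmetric] mult_1)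
  hence "suminf f * (of_nat p powr s - 1) = zeta_series s" by (simp add: algebra_simps)
  moreover have "of_nat p powr s - 1 \<noteq> (0::complex)"
    using norm_powr_minus_1_ge[OF p2, of s] s p2 by (auto simp del: norm_eq_zero)
  ultimately have "suminf f = zeta_series s / (of_nat p powr s - 1)" by (simp add: field_simps)
  thus "(\<lambda>n. of_nat (multiplicity p n) * inv_pow n s) sums (zeta_series s / (of_nat p powr s - 1))"
    using sf by (simp add: f_def [abs_def])
qed

text \<open>This is the logarithm of the prime factorization of \<open>n\<close>.\<close>
lemma sum_prime_ln_multiplicity:
  assumes n: "n > 0"
  shows "((\<lambda>p. prime_ln p * real (multiplicity p n)) has_sum ln (real n)) UNIV"
proof -
  have "((\<lambda>p. prime_ln p * real (multiplicity p n)) has_sum (\<Sum>p\<in>prime_factors n. prime_ln p * real (multiplicity p n))) (prime_factors n)"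
    by (rule has_sum_finite) simp
  moreover have "(\<Sum>p\<in>prime_factors n. prime_ln p * real (multiplicity p n)) = (\<Sum>p\<in>prime_factors n. ln (real p ^ multiplicity p n))"
    by (intro sum.cong) (auto simp: prime_ln_def ln_realpow prime_gt_0_nat in_prime_factors_iff)
  also have "\<dots> = ln (\<Prod>p\<in>prime_factors n. real p ^ multiplicity p n)"
    by (rule ln_prod [symmetric]) (auto simp: in_prime_factors_iff prime_gt_0_nat)
  also have "(\<Prod>p\<in>prime_factors n. real p ^ multiplicity p n) = real (\<Prod>p\<in>prime_factors n. p ^ multiplicity p n)"
    by simp
  also have "(\<Prod>p\<in>prime_factors n. p ^ multiplicity p n) = n"
    using n by (simp add: prime_factorization_nat [symmetric])
  ultimately have "((\<lambda>p. prime_ln p * real (multiplicity p n)) has_sum ln (real n)) (prime_factors n)" by simp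
  thus ?thesis
  proof (rule has_sum_cong_neutral[THEN iffD1, rotated -1])
    fix p assume "p \<in> UNIV - prime_factors n"
    hence "\<not> prime p \<or> multiplicity p n = 0" using n by (auto simp: in_prime_factors_iff not_dvd_imp_multiplicity_0)
    thus "prime_ln p * real (multiplicity p n) = 0" by (auto simp: prime_ln_def)
  qed auto
qed

lemma has_sum_suminf:
  fixes f :: "nat \<Rightarrow> 'a :: banach"
  assumes "summable (\<lambda>n. norm (f n))"
  shows "(f has_sum suminf f) UNIV"
  using assms summable_sums[OF summable_norm_cancel[OF assms]] by (rule norm_summable_imp_has_sum)

text \<open>Both sides are the double sum of \<open>ln p * multiplicity p n * n powr (- s)\<close>: summing over the primes \<open>p\<close>
  first yields the right-hand side, summing over \<open>n\<close> first yields \<open>\<zeta>(s) * ln p / (p powr s - 1)\<close> for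
  every \<open>p\<close>. The right-hand side is \<open>- \<zeta>'(s)\<close>, so this is the logarithmic derivative of the Euler product.\<close>
lemma zeta_series_times_prime_series:
  assumes s: "Re s > 1"
  shows "zeta_series s * (prime_series s + prime_remainder s) = (\<Sum>n. of_real (ln (real n)) * inv_pow n s)"
proof -
  define g :: "nat \<Rightarrow> nat \<Rightarrow> complex" where
    "g n p = of_real (prime_ln p * real (multiplicity p n)) * inv_pow n s" for n p
  have gn: "(g n has_sum (of_real (ln (real n)) * inv_pow n s)) UNIV" for n
  proof (cases "n = 0")
    case False
    hence "((\<lambda>p. of_real (prime_ln p * real (multiplicity p n)) :: complex) has_sum of_real (ln (real n))) UNIV"
      by (intro has_sum_of_real sum_prime_ln_multiplicity) simp
    thus ?thesis unfolding g_def [abs_def] by (rule has_sum_cmult_left)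
  qed (simp add: g_def [abs_def])
  have gabs: "((\<lambda>p. norm (g n p)) has_sum (ln (real n) * real n powr (- Re s))) UNIV" for n
  proof (cases "n = 0")
    case False
    have "norm (g n p) = prime_ln p * real (multiplicity p n) * real n powr (- Re s)" for p
      using prime_ln_nonneg[of p] by (simp add: g_def norm_mult norm_inv_pow)
    thus ?thesis using False sum_prime_ln_multiplicity[of n] by (auto intro!: has_sum_cmult_left)
  qed (simp add: g_def [abs_def])
  have sm: "(\<lambda>x. norm (case x of (n, p) \<Rightarrow> g n p)) summable_on (UNIV \<times> UNIV)"
  proof (rule Infinite_Sum.abs_summable_on_Sigma_iff[THEN iffD2], intro conjI ballI)
    show "(\<lambda>y. norm (case (x, y) of (n, p) \<Rightarrow> g n p)) summable_on UNIV" for x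
      using gabs[of x] by (auto simp: summable_on_def)
    have "infsum (\<lambda>p. norm (g n p)) UNIV = ln (real n) * real n powr (- Re s)" for n
      using gabs by (rule infsumI)
    thus "(\<lambda>x. norm (\<Sum>\<^sub>\<infinity>y\<in>UNIV. norm (case (x, y) of (n, p) \<Rightarrow> g n p))) summable_on UNIV"
      using norm_summable_imp_summable_on[of "\<lambda>n. norm (ln (real n) * real n powr (- Re s))"]
        summable_ln_powr[OF s] has_field_derivative_zeta_series(2)[OF s]
      by (simp add: norm_mult norm_inv_pow abs_mult)
  qed
  have col: "infsum (\<lambda>n. g n p) UNIV = zeta_series s * (of_real (prime_ln p) * inv_pow p s + remainder_term p s)" for p
  proof (cases "prime p")
    case True
    have p2: "p \<ge> 2" using True by (rule prime_ge_2_nat)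
    have nz: "of_nat p powr s - 1 \<noteq> (0::complex)"
      using norm_powr_minus_1_ge[OF p2, of s] s p2 by (auto simp del: norm_eq_zero)
    have nz': "of_nat p powr s \<noteq> (0::complex)" using p2 by simp
    have "((\<lambda>n. of_nat (multiplicity p n) * inv_pow n s) has_sum (zeta_series s / (of_nat p powr s - 1))) UNIV"
      by (rule norm_summable_imp_has_sum[OF multiplicity_series(2,1)[OF True s]])
    hence "((\<lambda>n. of_real (prime_ln p) * (of_nat (multiplicity p n) * inv_pow n s)) has_sum (of_real (prime_ln p) * (zeta_series s / (of_nat p powr s - 1)))) UNIV"
      by (rule has_sum_cmult_right)
    hence "infsum (\<lambda>n. g n p) UNIV = of_real (prime_ln p) * (zeta_series s / (of_nat p powr s - 1))"
      by (intro infsumI) (simp add: g_def mult.assoc)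
    also have "\<dots> = zeta_series s * (of_real (prime_ln p) * inv_pow p s + remainder_term p s)"
      unfolding remainder_term_def powr_minus using nz nz' by (simp add: field_simps)
    finally show ?thesis .
  qed (simp add: g_def prime_ln_def remainder_term_def)
  have "(\<Sum>n. of_real (ln (real n)) * inv_pow n s) = infsum (\<lambda>n. of_real (ln (real n)) * inv_pow n s) UNIV"
    by (rule infsumI[OF has_sum_suminf[OF has_field_derivative_zeta_series(2)[OF s]], symmetric])
  also have "\<dots> = infsum (\<lambda>n. infsum (\<lambda>p. g n p) UNIV) UNIV"
    using infsumI[OF gn] by simp
  also have "\<dots> = infsum (\<lambda>p. infsum (\<lambda>n. g n p) UNIV) UNIV"
    using abs_summable_summable[OF sm] by (rule infsum_swap_banach)
  also have "\<dots> = infsum (\<lambda>p. zeta_series s * (of_real (prime_ln p) * inv_pow p s + remainder_term p s)) UNIV"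
    by (simp only: col)
  also have "\<dots> = zeta_series s * (prime_series s + prime_remainder s)"
  proof (rule infsumI, rule has_sum_cmult_right, rule has_sum_add)
    show "((\<lambda>p. of_real (prime_ln p) * inv_pow p s) has_sum prime_series s) UNIV" unfolding prime_series_def
      by (rule has_sum_suminf[OF summable_prime_series[OF s]])
    show "((\<lambda>p. remainder_term p s) has_sum prime_remainder s) UNIV" unfolding prime_remainder_def
      by (rule has_sum_suminf[OF summable_remainder_term]) (use s in simp)
  qed
  finally show ?thesis ..
qed

text \<open>The identity is stated without dividing by \<open>zeta_times_pole s\<close>, whose zeros are excluded only with its help.\<close>
lemma deriv_zeta_times_pole:
  assumes s: "Re s > 1"
  shows "deriv zeta_times_pole s = zeta_times_pole s * (1 / (s - 1) - prime_series s - prime_remainder s)"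
proof -
  have op: "open {s. Re s > 1}" by (rule open_halfspace_Re_gt)
  have s1: "s \<noteq> 1" using s by auto
  have "((\<lambda>s. (s - 1) * zeta_series s) has_field_derivative
      (zeta_series s - (s - 1) * (\<Sum>n. of_real (ln (real n)) * inv_pow n s))) (at s)"
    by (rule derivative_eq_intros has_field_derivative_zeta_series(1)[OF s] refl)+ simp
  hence "(zeta_times_pole has_field_derivative (zeta_series s - (s - 1) * (\<Sum>n. of_real (ln (real n)) * inv_pow n s))) (at s)"
    by (rule has_field_derivative_transform_within_open[OF _ op]) (use s in \<open>auto simp: zeta_times_pole_eq\<close>)
  hence "deriv zeta_times_pole s = zeta_series s - (s - 1) * (zeta_series s * (prime_series s + prime_remainder s))"
    using zeta_series_times_prime_series[OF s] by (simp add: DERIV_imp_deriv)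
  also have "\<dots> = (s - 1) * zeta_series s * (1 / (s - 1) - prime_series s - prime_remainder s)"
    using s1 by (simp add: right_diff_distrib distrib_left)
  finally show ?thesis by (simp only: zeta_times_pole_eq[OF s])
qed

section \<open>Non-vanishing on the line with real part one\<close>

text \<open>Near \<open>a\<close> the logarithmic derivative behaves like \<open>n / (z - a)\<close>, where \<open>n\<close> is the order of the zero at \<open>a\<close>
  (\<open>0\<close> if \<open>f\<close> does not vanish there). This translates statements on zeros into limits
  along the horizontal ray to the right of \<open>a\<close>, on which Dirichlet series can be estimated.\<close>
lemma logderiv_order:
  fixes f :: "complex \<Rightarrow> complex"
  assumes f: "f holomorphic_on S" and S: "open S" "connected S" and a: "a \<in> S"
    and b: "b \<in> S" "f b \<noteq> 0"
  obtains n :: nat where "f a = 0 \<longleftrightarrow> n > 0"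
    "eventually (\<lambda>d. f (a + of_real d) \<noteq> 0) (at_right (0::real))"
    "((\<lambda>d. of_real d * (deriv f (a + of_real d) / f (a + of_real d))) \<longlongrightarrow> of_nat n) (at_right (0::real))"
proof -
  have "\<exists>n g r. (f a = 0 \<longleftrightarrow> n > 0) \<and> 0 < r \<and> ball a r \<subseteq> S \<and> g holomorphic_on ball a r \<and>
      (\<forall>w\<in>ball a r. f w = (w - a) ^ n * g w) \<and> g a \<noteq> 0"
  proof (cases "f a = 0")
    case True
    have "\<not> f constant_on S" using True a b unfolding constant_on_def by metis
    then obtain g r n where *: "0 < n" "0 < r" "ball a r \<subseteq> S" "g holomorphic_on ball a r"
        "\<And>w. w \<in> ball a r \<Longrightarrow> f w = (w - a) ^ n * g w" "\<And>w. w \<in> ball a r \<Longrightarrow> g w \<noteq> 0"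
      using holomorphic_factor_zero_nonconstant[OF f S a True] by metis
    thus ?thesis using True by (intro exI[of _ n] exI[of _ g] exI[of _ r]) auto
  next
    case False
    obtain r where r: "r > 0" "ball a r \<subseteq> S" using S(1) a by (meson openE)
    thus ?thesis using False f by (intro exI[of _ 0] exI[of _ f] exI[of _ r]) (auto intro: holomorphic_on_subset)
  qed
  then obtain n g r where n: "f a = 0 \<longleftrightarrow> n > 0" and r: "0 < r" "ball a r \<subseteq> S"
    and g: "g holomorphic_on ball a r" "g a \<noteq> 0" and fg: "\<And>w. w \<in> ball a r \<Longrightarrow> f w = (w - a) ^ n * g w"
    by blast
  have path: "((\<lambda>d::real. a + of_real d) \<longlongrightarrow> a) (at_right 0)"
    by (auto intro!: tendsto_eq_intros)
  have cg: "isCont g a"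
    using g(1) r(1) by (meson centre_in_ball continuous_on_interior holomorphic_on_imp_continuous_on interior_open open_ball continuous_on_eq_continuous_at)
  have cdg: "isCont (deriv g) a"
    using holomorphic_deriv[OF g(1) open_ball] r(1)
    by (meson centre_in_ball holomorphic_on_imp_continuous_on open_ball continuous_on_eq_continuous_at)
  have tg: "((\<lambda>d::real. g (a + of_real d)) \<longlongrightarrow> g a) (at_right 0)"
    by (rule isCont_tendsto_compose[OF cg path])
  have tdg: "((\<lambda>d::real. deriv g (a + of_real d)) \<longlongrightarrow> deriv g a) (at_right 0)"
    by (rule isCont_tendsto_compose[OF cdg path])
  have ev: "eventually (\<lambda>d::real. d > 0 \<and> a + of_real d \<in> ball a r \<and> g (a + of_real d) \<noteq> 0) (at_right 0)"
  proof (intro eventually_conj)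
    show "eventually (\<lambda>d::real. d > 0) (at_right 0)" by (simp add: eventually_at_right_less)
    show "eventually (\<lambda>d::real. a + of_real d \<in> ball a r) (at_right 0)"
      by (rule topological_tendstoD[OF path]) (use r in auto)
    show "eventually (\<lambda>d::real. g (a + of_real d) \<noteq> 0) (at_right 0)"
      by (rule tendsto_imp_eventually_ne[OF tg g(2)])
  qed
  have val: "of_real d * (deriv f (a + of_real d) / f (a + of_real d)) =
      of_nat n + of_real d * (deriv g (a + of_real d) / g (a + of_real d))"
    if d: "d > 0" "a + of_real d \<in> ball a r" "g (a + of_real d) \<noteq> 0" for d :: real
  proof -
    define w where "w = a + of_real d"
    have w: "w \<in> ball a r" "g w \<noteq> 0" "w - a = of_real d" using d by (auto simp: w_def)
    have "(g has_field_derivative deriv g w) (at w)"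
      using g(1) w(1) holomorphic_derivI open_ball by blast
    hence "((\<lambda>w. (w - a) ^ n * g w) has_field_derivative
        (of_nat n * (w - a) ^ (n - 1) * g w + (w - a) ^ n * deriv g w)) (at w)"
      by (auto intro!: derivative_eq_intros)
    hence "(f has_field_derivative (of_nat n * (w - a) ^ (n - 1) * g w + (w - a) ^ n * deriv g w)) (at w)"
      by (rule has_field_derivative_transform_within_open[OF _ open_ball w(1)]) (simp add: fg)
    hence df: "deriv f w = of_nat n * (w - a) ^ (n - 1) * g w + (w - a) ^ n * deriv g w"
      by (rule DERIV_imp_deriv)
    have d0: "of_real d \<noteq> (0::complex)" using d by simp
    have "of_real d * deriv f w = (of_nat n * g w + of_real d * deriv g w) * of_real d ^ n"
    proof (cases n)
      case 0 thus ?thesis by (simp add: df w(3))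
    next
      case (Suc m)
      thus ?thesis unfolding df w(3) by (simp add: algebra_simps)
    qed
    moreover have "f w = of_real d ^ n * g w" using fg[OF w(1)] w(3) by simp
    ultimately have "of_real d * (deriv f w / f w) = (of_nat n * g w + of_real d * deriv g w) / g w"
      using d0 w(2) by (simp add: field_simps)
    also have "\<dots> = of_nat n + of_real d * (deriv g w / g w)" using w(2) by (simp add: field_simps)
    finally show ?thesis by (simp add: w_def)
  qed
  show ?thesis
  proof
    show "f a = 0 \<longleftrightarrow> n > 0" by (fact n)
    show "eventually (\<lambda>d. f (a + of_real d) \<noteq> 0) (at_right (0::real))"
      by (rule eventually_mono[OF ev]) (auto simp: fg)
    have "((\<lambda>d. of_nat n + of_real d * (deriv g (a + of_real d) / g (a + of_real d))) \<longlongrightarrow>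
        of_nat n + of_real 0 * (deriv g a / g a)) (at_right (0::real))"
      by (intro tendsto_intros tg tdg g(2))
    hence "((\<lambda>d. of_nat n + of_real d * (deriv g (a + of_real d) / g (a + of_real d))) \<longlongrightarrow>
        of_nat n) (at_right (0::real))" by simp
    thus "((\<lambda>d. of_real d * (deriv f (a + of_real d) / f (a + of_real d))) \<longlongrightarrow> of_nat n) (at_right (0::real))"
      by (rule Lim_transform_eventually) (rule eventually_mono[OF ev], use val in auto)
  qed
qed

text \<open>Termwise, this is \<open>3 + 4 * cos \<theta> + cos (2 * \<theta>) = 2 * (1 + cos \<theta>)\<^sup>2\<close> with \<open>\<theta> = t * ln n\<close>.\<close>
lemma Re_prime_series_341: 
  assumes "x > 1"
  shows "0 \<le> 3 * Re (prime_series (of_real x)) + 4 * Re (prime_series (Complex x t)) + Re (prime_series (Complex x (2 * t)))"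
proof -
  have re: "(\<lambda>n. prime_ln n * real n powr (- x) * cos (u * ln (real n))) sums Re (prime_series (Complex x u))" for u
  proof -
    have "summable (\<lambda>n. norm (of_real (prime_ln n) * inv_pow n (Complex x u)))"
      by (rule summable_prime_series) (use assms in simp)
    hence "(\<lambda>n. of_real (prime_ln n) * inv_pow n (Complex x u)) sums prime_series (Complex x u)"
      unfolding prime_series_def by (intro summable_sums) (rule summable_norm_cancel)
    hence "(\<lambda>n. Re (of_real (prime_ln n) * inv_pow n (Complex x u))) sums Re (prime_series (Complex x u))"
      by (rule sums_Re)
    moreover have "Re (of_real (prime_ln n) * inv_pow n (Complex x u)) = prime_ln n * real n powr (- x) * cos (u * ln (real n))" for n
    proof (cases "n = 0")
      case False
      have "Ln (of_nat n) = of_real (ln (real n))" using False by (simp flip: Ln_of_nat)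
      thus ?thesis using False
        by (simp add: powr_def Re_exp mult.commute)
    qed (simp add: prime_ln_def)
    ultimately show ?thesis by (simp only:)
  qed
  have "(\<lambda>n. 3 * (prime_ln n * real n powr (- x) * cos (0 * ln (real n))) +
        4 * (prime_ln n * real n powr (- x) * cos (t * ln (real n))) +
        prime_ln n * real n powr (- x) * cos (2 * t * ln (real n))) sums
      (3 * Re (prime_series (Complex x 0)) + 4 * Re (prime_series (Complex x t)) + Re (prime_series (Complex x (2 * t))))"
    by (intro sums_add sums_mult re)
  moreover have "3 * (prime_ln n * real n powr (- x) * cos (0 * ln (real n))) +
        4 * (prime_ln n * real n powr (- x) * cos (t * ln (real n))) +
        prime_ln n * real n powr (- x) * cos (2 * t * ln (real n)) \<ge> 0" for n
  proof -
    define c where "c = cos (t * ln (real n))"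
    have dbl: "cos (2 * t * ln (real n)) = 2 * c\<^sup>2 - 1"
      using cos_double_cos[of "t * ln (real n)"] by (simp add: c_def mult.assoc)
    have "3 * (prime_ln n * real n powr (- x) * cos (0 * ln (real n))) +
        4 * (prime_ln n * real n powr (- x) * cos (t * ln (real n))) +
        prime_ln n * real n powr (- x) * cos (2 * t * ln (real n)) =
        prime_ln n * real n powr (- x) * (2 * (1 + c)\<^sup>2)"
      unfolding c_def[symmetric] dbl by (simp add: power2_eq_square algebra_simps)
    also have "\<dots> \<ge> 0" by (intro mult_nonneg_nonneg prime_ln_nonneg) auto
    finally show ?thesis .
  qed
  ultimately have "0 \<le> 3 * Re (prime_series (Complex x 0)) + 4 * Re (prime_series (Complex x t)) + Re (prime_series (Complex x (2 * t)))"
    by (rule sums_le[OF _ sums_zero, rotated])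
  thus ?thesis by (simp add: complex_of_real_def)
qed

lemma zeta_times_pole_order:
  assumes a: "Re a > 0"
  obtains n :: nat where "zeta_times_pole a = 0 \<longleftrightarrow> n > 0"
    "eventually (\<lambda>d. zeta_times_pole (a + of_real d) \<noteq> 0) (at_right (0::real))"
    "((\<lambda>d. of_real d * (deriv zeta_times_pole (a + of_real d) / zeta_times_pole (a + of_real d))) \<longlongrightarrow> of_nat n) (at_right (0::real))"
proof (rule logderiv_order[OF holomorphic_zeta_times_pole, of a 1])
  show "open {s. Re s > 0}" by (rule open_halfspace_Re_gt)
  show "connected {s. Re s > 0}" by (intro convex_connected convex_halfspace_Re_gt)
qed (use a that in \<open>auto simp: zeta_times_pole_1\<close>)

lemma tendsto_mult_bounded:
  fixes f :: "real \<Rightarrow> complex"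
  assumes "eventually (\<lambda>d. norm (f d) \<le> C) (at_right 0)"
  shows "((\<lambda>d. of_real d * f d) \<longlongrightarrow> 0) (at_right 0)"
proof (rule Lim_null_comparison)
  show "\<forall>\<^sub>F d in at_right 0. norm (of_real d * f d) \<le> \<bar>d\<bar> * C"
    by (rule eventually_mono[OF assms]) (simp add: norm_mult mult_left_mono)
  show "((\<lambda>d. \<bar>d\<bar> * C) \<longlongrightarrow> 0) (at_right 0)" by (auto intro!: tendsto_eq_intros)
qed

text \<open>The series over the primes has a simple pole with residue \<open>1\<close> at the pole of zeta, and one with
  residue \<open>- n\<close> at a zero of order \<open>n\<close>.\<close>
lemma prime_series_residue:
  assumes a: "Re a = 1"
  obtains n :: nat where "zeta_times_pole a = 0 \<longleftrightarrow> n > 0"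
    "((\<lambda>d. of_real d * prime_series (a + of_real d)) \<longlongrightarrow> (if a = 1 then 1 else 0) - of_nat n) (at_right (0::real))"
proof -
  obtain n where n: "zeta_times_pole a = 0 \<longleftrightarrow> n > 0"
    "eventually (\<lambda>d. zeta_times_pole (a + of_real d) \<noteq> 0) (at_right (0::real))"
    "((\<lambda>d. of_real d * (deriv zeta_times_pole (a + of_real d) / zeta_times_pole (a + of_real d))) \<longlongrightarrow> of_nat n) (at_right (0::real))"
    using zeta_times_pole_order[of a] a by auto
  have pos: "eventually (\<lambda>d::real. d > 0) (at_right 0)" by (simp add: eventually_at_right_less)
  have t1: "((\<lambda>d::real. of_real d * (1 / (a + of_real d - 1))) \<longlongrightarrow> (if a = 1 then 1 else 0)) (at_right 0)"
  proof (cases "a = 1")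
    case True
    have "\<forall>\<^sub>F d::real in at_right 0. 1 = of_real d * (1 / (a + of_real d - 1))"
      by (rule eventually_mono[OF pos]) (simp add: True)
    hence "((\<lambda>d::real. of_real d * (1 / (a + of_real d - 1))) \<longlongrightarrow> 1) (at_right 0)"
      by (rule Lim_transform_eventually[OF tendsto_const])
    thus ?thesis using True by simp
  next
    case False
    have "((\<lambda>d::real. of_real d * (1 / (a + of_real d - 1))) \<longlongrightarrow> of_real 0 * (1 / (a + of_real 0 - 1))) (at_right 0)"
      using False by (intro tendsto_intros) auto
    thus ?thesis using False by simp
  qed
  have t2: "((\<lambda>d. of_real d * prime_remainder (a + of_real d)) \<longlongrightarrow> 0) (at_right (0::real))"
    by (rule tendsto_mult_bounded[where C = "\<Sum>n. 2 * (ln (real n) * real n powr (- 2))"],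
        rule eventually_mono[OF pos], rule norm_prime_remainder_le) (use a in auto)
  have "((\<lambda>d. of_real d * (1 / (a + of_real d - 1)) -
        of_real d * (deriv zeta_times_pole (a + of_real d) / zeta_times_pole (a + of_real d)) -
        of_real d * prime_remainder (a + of_real d)) \<longlongrightarrow> (if a = 1 then 1 else 0) - of_nat n - 0) (at_right (0::real))"
    by (intro tendsto_diff t1 n(3) t2)
  moreover have "\<forall>\<^sub>F d::real in at_right 0. of_real d * (1 / (a + of_real d - 1)) -
        of_real d * (deriv zeta_times_pole (a + of_real d) / zeta_times_pole (a + of_real d)) -
        of_real d * prime_remainder (a + of_real d) = of_real d * prime_series (a + of_real d)"
    using pos n(2)
  proof eventually_elim
    case (elim d)
    hence "deriv zeta_times_pole (a + of_real d) / zeta_times_pole (a + of_real d) =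
        1 / (a + of_real d - 1) - prime_series (a + of_real d) - prime_remainder (a + of_real d)"
      using deriv_zeta_times_pole[of "a + of_real d"] a by simp
    thus ?case by (simp only: right_diff_distrib) simp
  qed
  ultimately have "((\<lambda>d. of_real d * prime_series (a + of_real d)) \<longlongrightarrow> (if a = 1 then 1 else 0) - of_nat n - 0) (at_right (0::real))"
    by (rule Lim_transform_eventually)
  thus ?thesis using n(1) that by simp
qed

text \<open>For \<open>Re a > 1\<close> the logarithmic derivative is bounded to the right of \<open>a\<close>, so the order at \<open>a\<close> is \<open>0\<close>.
  A zero of order \<open>n1 \<ge> 1\<close> at \<open>1 + \<i> * t\<close> would give the nonnegative combination of
  \<open>Re_prime_series_341\<close> a leading coefficient of at most \<open>3 - 4 * n1 < 0\<close>.\<close>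
lemma zeta_times_pole_nonzero:
  assumes "Re a \<ge> 1"
  shows "zeta_times_pole a \<noteq> 0"
proof (cases "Re a > 1")
  case True
  obtain n where n: "zeta_times_pole a = 0 \<longleftrightarrow> n > 0"
    "eventually (\<lambda>d. zeta_times_pole (a + of_real d) \<noteq> 0) (at_right (0::real))"
    "((\<lambda>d. of_real d * (deriv zeta_times_pole (a + of_real d) / zeta_times_pole (a + of_real d))) \<longlongrightarrow> of_nat n) (at_right (0::real))"
    using zeta_times_pole_order[of a] True by auto
  have pos: "eventually (\<lambda>d::real. d > 0) (at_right 0)" by (simp add: eventually_at_right_less)
  define C where "C = 1 / (Re a - 1) + (\<Sum>n. prime_ln n * real n powr (- Re a)) +
      (\<Sum>n. 2 * (ln (real n) * real n powr (- 2)))"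
  have sm: "summable (\<lambda>n. prime_ln n * real n powr (- Re a))"
    using summable_prime_series[OF True] prime_ln_nonneg by (simp add: norm_mult norm_inv_pow)
  have "\<forall>\<^sub>F d::real in at_right 0. norm (deriv zeta_times_pole (a + of_real d) / zeta_times_pole (a + of_real d)) \<le> C"
    using pos n(2)
  proof eventually_elim
    case (elim d)
    define s where "s = a + of_real d"
    have s: "Re s > Re a" "Re s > 1" using True elim by (auto simp: s_def)
    have "deriv zeta_times_pole s / zeta_times_pole s = 1 / (s - 1) - prime_series s - prime_remainder s"
      using deriv_zeta_times_pole[OF s(2)] elim by (simp add: s_def)
    also have "norm \<dots> \<le> norm (1 / (s - 1)) + norm (prime_series s) + norm (prime_remainder s)"
      by (meson add_mono norm_triangle_ineq4 order_trans order_refl)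
    also have "\<dots> \<le> C" unfolding C_def
    proof (intro add_mono)
      have "Re a - 1 \<le> norm (s - 1)" using complex_Re_le_cmod[of "s - 1"] s by simp
      thus "norm (1 / (s - 1)) \<le> 1 / (Re a - 1)" using True by (simp add: norm_divide frac_le)
      show "norm (prime_series s) \<le> (\<Sum>n. prime_ln n * real n powr (- Re a))" unfolding prime_series_def
      proof (rule norm_suminf_le[OF _ sm])
        fix k show "norm (of_real (prime_ln k) * inv_pow k s) \<le> prime_ln k * real k powr (- Re a)"
          using s prime_ln_nonneg[of k]
          by (cases "k = 0") (auto simp: norm_mult norm_inv_pow prime_ln_nonneg intro!: mult_left_mono powr_mono)
      qed
      show "norm (prime_remainder s) \<le> (\<Sum>n. 2 * (ln (real n) * real n powr (- 2)))"
        using s by (intro norm_prime_remainder_le) simp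
    qed
    finally show ?case by (simp add: s_def)
  qed
  hence "((\<lambda>d. of_real d * (deriv zeta_times_pole (a + of_real d) / zeta_times_pole (a + of_real d))) \<longlongrightarrow> 0) (at_right (0::real))"
    by (rule tendsto_mult_bounded)
  hence "of_nat n = (0::complex)" using n(3) tendsto_unique[OF trivial_limit_at_right_real] by blast
  thus ?thesis using n(1) by simp
next
  case False
  hence a1: "Re a = 1" using assms by simp
  show ?thesis
  proof
    assume zero: "zeta_times_pole a = 0"
    hence ane: "a \<noteq> 1" using zeta_times_pole_1 by auto
    define t where "t = Im a"
    have a: "a = Complex 1 t" using a1 by (simp add: t_def complex_eq_iff)
    have t: "t \<noteq> 0" using ane a by (auto simp: complex_eq_iff)
    obtain n0 where n0: "zeta_times_pole 1 = 0 \<longleftrightarrow> n0 > 0"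
      "((\<lambda>d. of_real d * prime_series (1 + of_real d)) \<longlongrightarrow> 1 - of_nat n0) (at_right (0::real))"
      using prime_series_residue[of 1] by auto
    obtain n1 where n1: "zeta_times_pole a = 0 \<longleftrightarrow> n1 > 0"
      "((\<lambda>d. of_real d * prime_series (a + of_real d)) \<longlongrightarrow> 0 - of_nat n1) (at_right (0::real))"
      using prime_series_residue[OF a1] ane by auto
    define a2 where "a2 = Complex 1 (2 * t)"
    have a2: "Re a2 = 1" "a2 \<noteq> 1" using t by (auto simp: a2_def complex_eq_iff)
    obtain n2 where n2: "zeta_times_pole a2 = 0 \<longleftrightarrow> n2 > 0"
      "((\<lambda>d. of_real d * prime_series (a2 + of_real d)) \<longlongrightarrow> 0 - of_nat n2) (at_right (0::real))"
      using prime_series_residue[OF a2(1)] a2(2) by auto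
    have "((\<lambda>d. 3 * Re (of_real d * prime_series (1 + of_real d)) + 4 * Re (of_real d * prime_series (a + of_real d)) +
        Re (of_real d * prime_series (a2 + of_real d))) \<longlongrightarrow>
        3 * Re (1 - of_nat n0) + 4 * Re (0 - of_nat n1) + Re (0 - of_nat n2)) (at_right (0::real))"
      by (intro tendsto_intros n0 n1 n2)
    moreover have "\<forall>\<^sub>F d in at_right (0::real). 0 \<le> 3 * Re (of_real d * prime_series (1 + of_real d)) +
        4 * Re (of_real d * prime_series (a + of_real d)) + Re (of_real d * prime_series (a2 + of_real d))"
      using eventually_at_right_less[of "0::real"]
    proof eventually_elim
      case (elim d)
      have "0 \<le> d * (3 * Re (prime_series (of_real (1 + d))) + 4 * Re (prime_series (Complex (1 + d) t)) + Re (prime_series (Complex (1 + d) (2 * t))))"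
        using elim by (intro mult_nonneg_nonneg Re_prime_series_341) auto
      moreover have "a + of_real d = Complex (1 + d) t" "a2 + of_real d = Complex (1 + d) (2 * t)"
        by (simp_all add: a a2_def complex_eq_iff)
      ultimately show ?case by (simp add: algebra_simps)
    qed
    ultimately have "0 \<le> 3 * Re (1 - of_nat n0) + 4 * Re (0 - of_nat n1) + Re (0 - of_nat n2)"
      by (intro tendsto_lowerbound) auto
    hence "0 \<le> 3 - 3 * real n0 - 4 * real n1 - real n2" by simp
    moreover have "n1 \<ge> 1" using n1(1) zero by simp
    hence "real n1 \<ge> 1" by simp
    moreover have "real n0 \<ge> 0" "real n2 \<ge> 0" by simp_all
    ultimately show False by linarith
  qed
qed

text \<open>Writing \<open>H\<close> for \<open>zeta_times_pole\<close>, the series is \<open>- H' / H - (H - 1) / (s - 1)\<close> up to the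
  harmless remainder: the pole \<open>1 / (s - 1)\<close> of \<open>- \<zeta>' / \<zeta>\<close> and that of \<open>\<zeta>\<close> cancel. The first quotient is
  continuous as \<open>H\<close> has no zeros, the second one as its singularity at \<open>1\<close> is removable by \<open>H 1 = 1\<close>.\<close>
lemma prime_series_boundary:
  obtains F where "continuous_on {s. Re s \<ge> 1} F"
    and "\<And>s. Re s > 1 \<Longrightarrow> (\<lambda>n. of_real (prime_ln n - 1) * inv_pow n s) sums F s"
proof
  define H where "H = {s::complex. Re s > 0}"
  define G where "G = (\<lambda>s. if s = 1 then deriv zeta_times_pole 1 else (zeta_times_pole s - zeta_times_pole 1) / (s - 1))"
  define F where "F = (\<lambda>s. - deriv zeta_times_pole s / zeta_times_pole s - G s - prime_remainder s)"
  have op: "open H" unfolding H_def by (rule open_halfspace_Re_gt)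
  have hol: "zeta_times_pole holomorphic_on H" using holomorphic_zeta_times_pole by (simp add: H_def)
  have sub: "{s. Re s \<ge> 1} \<subseteq> H" by (auto simp: H_def)
  have "G holomorphic_on H" unfolding G_def by (rule pole_lemma_open[OF hol op])
  hence "continuous_on {s. Re s \<ge> 1} G" "continuous_on {s. Re s \<ge> 1} zeta_times_pole"
      "continuous_on {s. Re s \<ge> 1} (deriv zeta_times_pole)"
    using hol holomorphic_deriv[OF hol op] sub
    by (meson holomorphic_on_imp_continuous_on continuous_on_subset)+
  thus "continuous_on {s. Re s \<ge> 1} F" unfolding F_def
    using zeta_times_pole_nonzero by (intro continuous_intros continuous_prime_remainder) auto
  fix s :: complex assume s: "Re s > 1"
  have "(\<lambda>n. of_real (prime_ln n) * inv_pow n s - inv_pow n s) sums (prime_series s - zeta_series s)"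
    unfolding prime_series_def zeta_series_def
    by (intro sums_diff summable_sums summable_inv_pow(2)[OF s] summable_norm_cancel[OF summable_prime_series[OF s]])
  moreover have "prime_series s - zeta_series s = F s"
  proof -
    have h0: "zeta_times_pole s \<noteq> 0" using zeta_times_pole_nonzero[of s] s by simp
    have s1: "s \<noteq> 1" "s - 1 \<noteq> 0" using s by auto
    have "deriv zeta_times_pole s / zeta_times_pole s = 1 / (s - 1) - prime_series s - prime_remainder s"
      using deriv_zeta_times_pole[OF s] h0 by simp
    moreover have "G s = zeta_series s - 1 / (s - 1)"
      using s1 by (simp add: G_def zeta_times_pole_1 zeta_times_pole_eq[OF s] diff_divide_distrib)
    ultimately show ?thesis unfolding F_def by (simp add: algebra_simps)
  qed
  ultimately show "(\<lambda>n. of_real (prime_ln n - 1) * inv_pow n s) sums F s"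
    by (simp add: algebra_simps)
qed

section \<open>Chebyshev's bound and sums with a Cauchy weight\<close>

lemma prod_primes_dvd:
  fixes m :: nat
  assumes "finite A" "\<And>p. p \<in> A \<Longrightarrow> prime p" "\<And>p. p \<in> A \<Longrightarrow> p dvd m"
  shows "\<Prod>A dvd m"
  using assms
proof (induction A rule: finite_induct)
  case (insert p A)
  have "coprime p (\<Prod>A)"
    using insert by (intro prod_coprime_right) (auto intro!: primes_coprime)
  thus ?case using insert by (simp add: divides_mult)
qed simp

text \<open>Chebyshev's argument: the product of the primes in the interval from \<open>m + 2\<close> to \<open>2 * m + 1\<close> divides the binomial
  coefficient \<open>(2 * m + 1) choose m\<close>, which is at most \<open>2 ^ (2 * m + 1)\<close>.\<close>
lemma sum_prime_ln_le: "(\<Sum>k\<le>n. prime_ln k) \<le> ln 8 * real n"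
proof (induction n rule: less_induct)
  case (less n)
  have ln8: "ln 8 = 3 * ln (2::real)"
    using ln_realpow[of 2 3] by simp
  have ln2: "ln (2::real) \<ge> 0" by simp
  consider "n \<le> 2" | "n > 2" "even n" | m where "n = 2 * m + 1" "m \<ge> 1"
    by (metis One_nat_def Suc_leI dvd_triv_left evenE linorder_not_le mult_0_right not_gr_zero numeral_2_eq_2 oddE plus_1_eq_Suc add.commute le_SucI le_refl)
  thus ?case
  proof cases
    case 1
    hence "n = 0 \<or> n = 1 \<or> n = 2" by auto
    thus ?thesis using ln2 by (auto simp: prime_ln_def numeral_2_eq_2 ln8)
  next
    case 2
    hence "\<not> prime n" using prime_odd_nat by auto
    moreover obtain k where k: "n = Suc k" using 2 by (cases n) auto
    ultimately have "(\<Sum>k\<le>n. prime_ln k) = (\<Sum>k\<le>k. prime_ln k)" by (simp add: prime_ln_def)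
    also have "\<dots> \<le> ln 8 * real k" by (rule less) (simp add: k)
    also have "\<dots> \<le> ln 8 * real n" using k by (intro mult_left_mono) auto
    finally show ?thesis .
  next
    case (3 m)
    define Q where "Q = {p. prime p \<and> m + 1 < p \<and> p \<le> n}"
    have finQ: "finite Q" by (rule finite_subset[of _ "{..n}"]) (auto simp: Q_def)
    have "\<Prod>Q dvd (n choose m)"
    proof -
      have "p dvd (n choose m)" if "p \<in> Q" for p
      proof -
        have p: "prime p" "m + 1 < p" "p \<le> n" using that by (auto simp: Q_def)
        have nm: "n - m = m + 1" using 3 by simp
        have "p dvd fact n" using p by (simp add: prime_dvd_fact_iff)
        also have "fact n = fact m * fact (n - m) * (n choose m)"
          using 3 by (intro binomial_fact_lemma [symmetric]) simp
        finally have "p dvd fact m * fact (m + 1) * (n choose m)" by (simp only: nm)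
        moreover have "\<not> p dvd fact m" "\<not> p dvd fact (m + 1)"
          using p by (simp_all add: prime_dvd_fact_iff del: fact_Suc)
        ultimately show ?thesis using p(1) by (metis prime_dvd_mult_nat)
      qed
      thus ?thesis using finQ by (intro prod_primes_dvd) (auto simp: Q_def)
    qed
    hence "\<Prod>Q \<le> n choose m" using 3 by (intro dvd_imp_le) auto
    also have "\<dots> \<le> 2 ^ n" by (rule binomial_le_pow2)
    finally have "real (\<Prod>Q) \<le> real (2 ^ n)" by (rule of_nat_mono)
    hence "(\<Prod>p\<in>Q. real p) \<le> 2 ^ n" by simp
    moreover have "(\<Prod>p\<in>Q. real p) > 0" by (rule prod_pos) (auto simp: Q_def)
    ultimately have "ln (\<Prod>p\<in>Q. real p) \<le> ln (2 ^ n)" by (subst ln_le_cancel_iff) auto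
    moreover have "ln (\<Prod>p\<in>Q. real p) = (\<Sum>p\<in>Q. ln (real p))"
      by (rule ln_prod) (auto simp: Q_def)
    ultimately have Q: "(\<Sum>p\<in>Q. ln (real p)) \<le> real n * ln 2" by (simp add: ln_realpow)
    have "(\<Sum>k\<le>n. prime_ln k) = (\<Sum>k\<le>m+1. prime_ln k) + (\<Sum>k\<in>{m+1<..n}. prime_ln k)"
    proof -
      have "{..n} = {..m+1} \<union> {m+1<..n}" using 3 by auto
      thus ?thesis by (simp add: sum.union_disjoint ivl_disj_int)
    qed
    also have "(\<Sum>k\<in>{m+1<..n}. prime_ln k) = (\<Sum>p\<in>Q. ln (real p))"
      by (rule sum.mono_neutral_cong_right) (auto simp: Q_def prime_ln_def)
    also have "(\<Sum>k\<le>m+1. prime_ln k) \<le> ln 8 * real (m + 1)" by (rule less) (use 3 in simp)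
    also note Q
    finally have "(\<Sum>k\<le>n. prime_ln k) \<le> ln 8 * real (m + 1) + real n * ln 2" by simp
    also have "\<dots> \<le> ln 8 * real n"
    proof -
      have "real n * ln 2 \<le> (3 * real m) * ln 2" using 3 ln2 by (intro mult_right_mono) auto
      thus ?thesis using 3 by (simp add: ln8 algebra_simps)
    qed
    finally show ?thesis .
  qed
qed

text \<open>Summation by parts, arranged as an induction on the stronger claim that the deficit is at least
  \<open>f N\<close> times the deficit of the unweighted sums.\<close>
lemma sum_weighted_le:
  fixes a f :: "nat \<Rightarrow> real"
  assumes A: "\<And>n. (\<Sum>k\<in>{1..n}. a k) \<le> C * real n"
    and f: "\<And>n. n \<ge> 1 \<Longrightarrow> f (Suc n) \<le> f n" "\<And>n. f n \<ge> 0"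
  shows "(\<Sum>k\<in>{1..N}. a k * f k) \<le> C * (\<Sum>k\<in>{1..N}. f k)"
proof -
  have "(C * real N - (\<Sum>k\<in>{1..N}. a k)) * f N \<le> (\<Sum>k\<in>{1..N}. (C - a k) * f k)"
  proof (induction N)
    case (Suc N)
    have "(C * real N - (\<Sum>k\<in>{1..N}. a k)) * f (Suc N) \<le> (C * real N - (\<Sum>k\<in>{1..N}. a k)) * f N"
      using A[of N] f(1)[of N] by (cases "N = 0") (auto intro!: mult_left_mono)
    also note Suc
    finally show ?case by (simp add: algebra_simps)
  qed simp
  moreover have "0 \<le> (C * real N - (\<Sum>k\<in>{1..N}. a k)) * f N"
    using A[of N] f(2)[of N] by (intro mult_nonneg_nonneg) auto
  ultimately have "0 \<le> (\<Sum>k\<in>{1..N}. (C - a k) * f k)" by linarith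
  thus ?thesis by (simp add: algebra_simps sum_subtractf sum_distrib_left)
qed

text \<open>A majorant, up to a constant, for the tails of the Fejer kernel at \<open>ln x - y\<close>, divided by \<open>x\<close>. Unlike the
  kernel it decreases in \<open>x\<close>, because its reciprocal has the derivative \<open>(1 + (ln x - y))\<^sup>2\<close>;
  so by \<open>sum_weighted_le\<close> a sum over primes is controlled by a sum over all integers.\<close>
definition cauchy_weight :: "real \<Rightarrow> real \<Rightarrow> real" where
  "cauchy_weight y x = 1 / (x * (1 + (ln x - y)\<^sup>2))"

lemma cauchy_weight_nonneg: "x \<ge> 0 \<Longrightarrow> cauchy_weight y x \<ge> 0"
  by (simp add: cauchy_weight_def add_nonneg_nonneg)

lemma cauchy_weight_antimono:
  assumes "0 < a" "a \<le> b"
  shows "cauchy_weight y b \<le> cauchy_weight y a"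
proof -
  have "a * (1 + (ln a - y)\<^sup>2) \<le> b * (1 + (ln b - y)\<^sup>2)"
  proof (rule DERIV_nonneg_imp_nondecreasing[OF assms(2)])
    fix x assume "a \<le> x"
    hence x: "x > 0" using assms by simp
    have "((\<lambda>x. x * (1 + (ln x - y)\<^sup>2)) has_real_derivative (1 + (ln x - y))\<^sup>2) (at x)"
      using x by (auto intro!: derivative_eq_intros simp: power2_eq_square field_simps)
    thus "\<exists>D. ((\<lambda>x. x * (1 + (ln x - y)\<^sup>2)) has_real_derivative D) (at x) \<and> 0 \<le> D"
      by (intro exI[of _ "(1 + (ln x - y))\<^sup>2"]) simp
  qed
  moreover have "a * (1 + (ln a - y)\<^sup>2) > 0" using assms by (intro mult_pos_pos add_pos_nonneg) auto
  ultimately show ?thesis unfolding cauchy_weight_def by (intro frac_le) auto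
qed

text \<open>The weight is the derivative of \<open>arctan (ln x - y)\<close> and decreases, so apart from its first term the
  sum is at most an increment of the arctangent.\<close>
lemma sum_cauchy_weight_le: "(\<Sum>k\<in>{1..N}. cauchy_weight y (real k)) \<le> 1 + pi"
proof -
  define A where "A x = arctan (ln x - y)" for x
  have dA: "(A has_real_derivative cauchy_weight y x) (at x)" if "x > 0" for x
  proof -
    have "((\<lambda>x. ln x - y) has_real_derivative 1 / x) (at x)"
      using that by (auto intro!: derivative_eq_intros)
    hence "(A has_real_derivative inverse (1 + (ln x - y)\<^sup>2) * (1 / x)) (at x)"
      unfolding A_def by (rule DERIV_chain2[OF DERIV_arctan])
    thus ?thesis by (simp add: cauchy_weight_def field_simps)
  qed
  have step: "cauchy_weight y (real (Suc k)) \<le> A (real (Suc k)) - A (real k)" if "k \<ge> 1" for k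
  proof -
    have "\<exists>z>real k. z < real (Suc k) \<and>
        A (real (Suc k)) - A (real k) = (real (Suc k) - real k) * cauchy_weight y z"
      by (rule MVT2) (use dA that in auto)
    then obtain z where z: "real k < z" "z < real (Suc k)"
        "A (real (Suc k)) - A (real k) = (real (Suc k) - real k) * cauchy_weight y z"
      by blast
    thus ?thesis using cauchy_weight_antimono[of z "real (Suc k)" y] that by simp
  qed
  have "(\<Sum>k\<in>{1..Suc N}. cauchy_weight y (real k)) \<le> 1 + (A (real (Suc N)) - A 1)" for N
  proof (induction N)
    case 0
    have "1 / (1 + y\<^sup>2) \<le> 1 / 1" by (intro divide_left_mono) (auto simp: add_pos_nonneg)
    thus ?case by (simp add: cauchy_weight_def)
  next
    case (Suc N)
    have "(\<Sum>k\<in>{1..Suc (Suc N)}. cauchy_weight y (real k)) =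
        (\<Sum>k\<in>{1..Suc N}. cauchy_weight y (real k)) + cauchy_weight y (real (Suc (Suc N)))"
      by (subst sum.nat_ivl_Suc') auto
    thus ?case using Suc step[of "Suc N"] by simp
  qed
  moreover have "A (real (Suc N)) - A 1 \<le> pi" for N
    unfolding A_def using arctan_bounded[of "ln (real (Suc N)) - y"] arctan_bounded[of "ln 1 - y"] by linarith
  ultimately have S: "(\<Sum>k\<in>{1..Suc N}. cauchy_weight y (real k)) \<le> 1 + pi" for N
    by (meson add_left_mono order_trans)
  show ?thesis using S[of "N - 1"] by (cases N) auto
qed

lemma sum_prime_ln_cauchy_weight_le:
  "(\<Sum>k<N. prime_ln k * cauchy_weight y (real k)) \<le> ln 8 * (1 + pi)"
proof -
  have "(\<Sum>k<N. prime_ln k * cauchy_weight y (real k)) \<le> (\<Sum>k\<in>{1..N}. prime_ln k * cauchy_weight y (real k))"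
  proof -
    have "(\<Sum>k<N. prime_ln k * cauchy_weight y (real k)) = (\<Sum>k\<in>{1..<N}. prime_ln k * cauchy_weight y (real k))"
      by (rule sum.mono_neutral_right) (auto simp: prime_ln_def not_less_eq_eq)
    also have "\<dots> \<le> (\<Sum>k\<in>{1..N}. prime_ln k * cauchy_weight y (real k))"
      by (rule sum_mono2) (auto intro!: mult_nonneg_nonneg prime_ln_nonneg cauchy_weight_nonneg)
    finally show ?thesis .
  qed
  also have "\<dots> \<le> ln 8 * (\<Sum>k\<in>{1..N}. cauchy_weight y (real k))"
  proof (rule sum_weighted_le)
    fix n
    have "(\<Sum>k\<in>{1..n}. prime_ln k) = (\<Sum>k\<le>n. prime_ln k)"
      by (rule sum.mono_neutral_left) (auto simp: prime_ln_def not_less_eq_eq)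
    thus "(\<Sum>k\<in>{1..n}. prime_ln k) \<le> ln 8 * real n" using sum_prime_ln_le[of n] by simp
  qed (auto intro!: cauchy_weight_antimono cauchy_weight_nonneg)
  also have "\<dots> \<le> ln 8 * (1 + pi)"
    by (intro mult_left_mono sum_cauchy_weight_le) auto
  finally show ?thesis .
qed

section \<open>The Fejer kernel and the Riemann-Lebesgue lemma\<close>

text \<open>The cosine transform of a triangular weight on the interval from \<open>0\<close> to \<open>L\<close>. Defining it as an integral
  gives it the right value \<open>L / 2\<close> at \<open>u = 0\<close>, where the closed form breaks down.\<close>
definition fejer :: "real \<Rightarrow> real \<Rightarrow> real" where
  "fejer L u = integral {0..L} (\<lambda>t. (1 - t / L) * cos (t * u))"

lemma fejer_integrable:
  fixes L u :: real
  shows "L \<noteq> 0 \<Longrightarrow> (\<lambda>t. (1 - t / L) * cos (t * u)) integrable_on {0..L}"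
  by (rule integrable_continuous_real) (auto intro!: continuous_intros)

lemma fejer_eq:
  assumes L: "L > 0" and u: "u \<noteq> 0"
  shows "fejer L u = (1 - cos (L * u)) / (L * u\<^sup>2)"
proof -
  define A where "A t = (1 - t / L) * sin (t * u) / u - cos (t * u) / (L * u\<^sup>2)" for t
  have "((\<lambda>t. (1 - t / L) * cos (t * u)) has_integral (A L - A 0)) {0..L}"
  proof (rule fundamental_theorem_of_calculus)
    fix t
    have "(A has_real_derivative (1 - t / L) * cos (t * u)) (at t within {0..L})"
      unfolding A_def using L u
      by (auto intro!: derivative_eq_intros simp: field_simps power2_eq_square)
    thus "(A has_vector_derivative (1 - t / L) * cos (t * u)) (at t within {0..L})"
      by (simp add: has_real_derivative_iff_has_vector_derivative)
  qed (use L in simp)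
  hence "fejer L u = A L - A 0" unfolding fejer_def by (rule integral_unique)
  thus ?thesis using L by (simp add: A_def diff_divide_distrib)
qed

lemma fejer_le:
  assumes "L > 0" "u \<noteq> 0"
  shows "fejer L u \<le> 2 / (L * u\<^sup>2)"
proof -
  have "1 - cos (L * u) \<le> 2" using cos_ge_minus_one[of "L * u"] by linarith
  thus ?thesis unfolding fejer_eq[OF assms] using assms by (intro divide_right_mono) auto
qed

lemma fejer_ge:
  assumes L: "L > 0" and u: "\<bar>u\<bar> \<le> 1 / L"
  shows "fejer L u \<ge> L / 4"
proof -
  define A where "A t = t / 2 - t\<^sup>2 / (4 * L)" for t
  have "((\<lambda>t. (1 - t / L) * (1 / 2)) has_integral (A L - A 0)) {0..L}"
  proof (rule fundamental_theorem_of_calculus)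
    fix t
    have "(A has_real_derivative (1 - t / L) * (1 / 2)) (at t within {0..L})"
      unfolding A_def using L
      by (auto intro!: derivative_eq_intros simp: field_simps)
    thus "(A has_vector_derivative (1 - t / L) * (1 / 2)) (at t within {0..L})"
      by (simp add: has_real_derivative_iff_has_vector_derivative)
  qed (use L in simp)
  moreover have "A L - A 0 = L / 4" using L by (simp add: A_def power2_eq_square field_simps)
  ultimately have I: "((\<lambda>t. (1 - t / L) * (1 / 2)) has_integral (L / 4)) {0..L}" by simp
  have J: "((\<lambda>t. (1 - t / L) * cos (t * u)) has_integral fejer L u) {0..L}"
    unfolding fejer_def using fejer_integrable[of L u] L by (intro integrable_integral) simp
  show ?thesis
  proof (rule has_integral_le[OF I J])
    fix t assume t: "t \<in> {0..L}"
    have "\<bar>t * u\<bar> \<le> L * (1 / L)" unfolding abs_mult using t u by (intro mult_mono) auto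
    hence tu: "\<bar>t * u\<bar> \<le> 1" using L by simp
    have "\<bar>sin (t * u / 2)\<bar> \<le> 1 / 2" using abs_sin_x_le_abs_x[of "t * u / 2"] tu by simp
    hence "(sin (t * u / 2))\<^sup>2 \<le> (1 / 2)\<^sup>2" by (rule power2_le_iff_abs_le[THEN iffD2, rotated]) simp
    moreover have "cos (t * u) = 1 - 2 * (sin (t * u / 2))\<^sup>2"
      using cos_double_sin[of "t * u / 2"] by simp
    ultimately have "cos (t * u) \<ge> 1 / 2" by (simp add: power2_eq_square)
    thus "(1 - t / L) * (1 / 2) \<le> (1 - t / L) * cos (t * u)"
      using t L by (intro mult_left_mono) (auto simp: field_simps)
  qed
qed

lemma fejer_nonneg: "L > 0 \<Longrightarrow> fejer L u \<ge> 0"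
  using fejer_ge[of L 0] by (cases "u = 0") (auto simp: fejer_eq)

text \<open>Shifting \<open>t\<close> by \<open>pi / y\<close> changes the sign of \<open>cis (t * y)\<close>. Hence twice the integral is the integral
  of \<open>cis (t * y) * (G t - G (t + pi / y))\<close> up to two short end pieces, and uniform continuity makes it small.\<close>
lemma riemann_lebesgue:
  fixes G :: "real \<Rightarrow> complex"
  assumes L: "L > 0" and G: "continuous_on {0..L} G"
  shows "((\<lambda>y. integral {0..L} (\<lambda>t. cis (t * y) * G t)) \<longlongrightarrow> 0) at_top"
proof (rule tendstoI)
  fix \<eta> :: real assume \<eta>: "\<eta> > 0"
  have "compact (G ` {0..L})" using G by (intro compact_continuous_image) auto
  then obtain M where M: "M > 0" "\<And>t. t \<in> {0..L} \<Longrightarrow> norm (G t) \<le> M"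
    using compact_imp_bounded bounded_pos by (metis (no_types, lifting) imageI)
  have "uniformly_continuous_on {0..L} G" using G by (intro compact_uniformly_continuous) auto
  then obtain d0 where d0: "d0 > 0"
    "\<And>s t. s \<in> {0..L} \<Longrightarrow> t \<in> {0..L} \<Longrightarrow> dist s t < d0 \<Longrightarrow> dist (G s) (G t) < \<eta> / (2 * L)"
    using \<eta> L unfolding uniformly_continuous_on_def by (metis dist_commute divide_pos_pos mult_pos_pos zero_less_numeral)
  define D where "D = Min {d0, L, \<eta> / (2 * M)}"
  have D: "D > 0" "D \<le> d0" "D \<le> L" "D \<le> \<eta> / (2 * M)" using d0 L \<eta> M by (auto simp: D_def)
  have "\<forall>\<^sub>F y in at_top. y > pi / D" by (rule eventually_gt_at_top)
  thus "\<forall>\<^sub>F y in at_top. dist (integral {0..L} (\<lambda>t. cis (t * y) * G t)) 0 < \<eta>"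
  proof eventually_elim
    case (elim y)
    have y: "y > 0" using elim D pi_gt_zero by (meson divide_pos_pos less_trans)
    define d where "d = pi / y"
    have d: "d > 0" "d < D" using y elim D by (auto simp: d_def field_simps)
    define e where "e t = cis (t * y) * G t" for t
    have ce: "continuous_on {0..L} e" unfolding e_def by (intro continuous_intros G)
    have ie: "e integrable_on {a..b}" if "a \<ge> 0" "b \<le> L" for a b
      using that by (intro integrable_continuous_real continuous_on_subset[OF ce]) auto
    have ne: "norm (e t) \<le> M" if "t \<in> {0..L}" for t using M that by (simp add: e_def norm_mult)
    have split1: "integral {0..L} e = integral {0..L-d} e + integral {L-d..L} e"
      using d D by (intro Henstock_Kurzweil_Integration.integral_combine[symmetric] ie) auto
    have split2: "integral {0..L} e = integral {0..d} e + integral {d..L} e"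
      using d D by (intro Henstock_Kurzweil_Integration.integral_combine[symmetric] ie) auto
    have "integral {0..L-d} (e \<circ> (\<lambda>x. x + d)) = integral {0+d..L-d+d} e"
      using d D by (intro integral_shift continuous_on_subset[OF ce]) auto
    hence shift: "integral {d..L} e = integral {0..L-d} (\<lambda>t. e (t + d))" by (simp add: o_def)
    have cdsh: "continuous_on {0..L-d} (\<lambda>t. e (t + d))"
      by (rule continuous_on_compose2[OF ce]) (use d in \<open>auto intro!: continuous_intros\<close>)
    have "2 * integral {0..L} e = integral {0..L-d} e + integral {0..L-d} (\<lambda>t. e (t + d)) +
        integral {L-d..L} e + integral {0..d} e"
      unfolding mult_2 shift[symmetric] by (subst split1, subst split2) simp
    also have "integral {0..L-d} e + integral {0..L-d} (\<lambda>t. e (t + d)) = integral {0..L-d} (\<lambda>t. e t + e (t + d))"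
      using d by (intro Henstock_Kurzweil_Integration.integral_add[symmetric] ie integrable_continuous_real cdsh) auto
    finally have two: "2 * integral {0..L} e = integral {0..L-d} (\<lambda>t. e t + e (t + d)) +
        integral {L-d..L} e + integral {0..d} e" .
    have b1: "norm (integral {0..L-d} (\<lambda>t. e t + e (t + d))) \<le> \<eta> / (2 * L) * (L - d - 0)"
    proof (rule integral_bound)
      show "continuous_on {0..L-d} (\<lambda>t. e t + e (t + d))"
        using d by (intro continuous_intros cdsh continuous_on_subset[OF ce]) auto
      fix t assume t: "t \<in> {0..L-d}"
      have "cis ((t + d) * y) = - cis (t * y)"
        using y by (simp add: d_def ring_distribs cis_mult [symmetric])
      hence "e t + e (t + d) = cis (t * y) * (G t - G (t + d))" by (simp add: e_def algebra_simps)
      hence "norm (e t + e (t + d)) = dist (G t) (G (t + d))" by (simp add: norm_mult dist_norm)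
      also have "\<dots> \<le> \<eta> / (2 * L)" using t d D by (intro less_imp_le d0(2)) (auto simp: dist_real_def)
      finally show "norm (e t + e (t + d)) \<le> \<eta> / (2 * L)" .
    qed (use d D in simp)
    have b2: "norm (integral {L-d..L} e) \<le> M * (L - (L - d))"
      using d D by (intro integral_bound continuous_on_subset[OF ce] ne) auto
    have b3: "norm (integral {0..d} e) \<le> M * (d - 0)"
      using d D by (intro integral_bound continuous_on_subset[OF ce] ne) auto
    have "2 * norm (integral {0..L} e) = norm (2 * integral {0..L} e)" by (simp add: norm_mult)
    also have "\<dots> \<le> \<eta> / (2 * L) * (L - d) + M * d + M * d"
      unfolding two using b1 b2 b3 by (intro norm_triangle_le add_mono) auto
    also have "\<dots> \<le> \<eta> / 2 + 2 * (M * d)"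
    proof -
      have "\<eta> / (2 * L) * (L - d) \<le> \<eta> / (2 * L) * L" using \<eta> L d by (intro mult_left_mono) auto
      thus ?thesis using L by simp
    qed
    also have "M * d < M * (\<eta> / (2 * M))" using d D M by (intro mult_strict_left_mono) auto
    hence "\<eta> / 2 + 2 * (M * d) < \<eta> / 2 + \<eta>" using M by simp
    finally show ?case using \<eta> unfolding e_def by simp
  qed
qed

section \<open>Primes in short intervals\<close>

lemma Re_of_real_mult: "Re (of_real r * z) = r * Re z"
  by simp

text \<open>For \<open>x > 1\<close> the series for \<open>F\<close> converges uniformly in \<open>t\<close> and can be integrated term by term; the
  integral of the \<open>n\<close>-th term is a value of the kernel. The left-hand side would be hard to control
  at \<open>x = 1\<close>, but the right-hand side is continuous there.\<close>
lemma fejer_sum: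
  assumes F: "continuous_on {s. Re s \<ge> 1} F"
    and Fs: "\<And>s. Re s > 1 \<Longrightarrow> (\<lambda>n. of_real (prime_ln n - 1) * inv_pow n s) sums F s"
    and L: "L > 0" and x: "x > 1"
  shows "(\<lambda>n. (prime_ln n - 1) * real n powr (- x) * fejer L (ln (real n) - y)) sums
    integral {0..L} (\<lambda>t. (1 - t / L) * Re (cis (t * y) * F (Complex x t)))"
proof -
  define a where "a n = (prime_ln n - 1) * real n powr (- x)" for n
  define f where "f n t = a n * ((1 - t / L) * cos (t * (ln (real n) - y)))" for n t
  define M where "M n = \<bar>a n\<bar>" for n
  have M: "summable M"
  proof (rule summable_comparison_test)
    show "\<exists>N. \<forall>n\<ge>N. norm (M n) \<le> ln (real n) * real n powr (- x) + real n powr (- x)"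
    proof (intro exI allI impI)
      fix n :: nat
      have "\<bar>prime_ln n - 1\<bar> \<le> ln (real n) + 1" using prime_ln_le[of n] prime_ln_nonneg[of n] by linarith
      hence "\<bar>prime_ln n - 1\<bar> * real n powr (- x) \<le> (ln (real n) + 1) * real n powr (- x)"
        by (rule mult_right_mono) simp
      thus "norm (M n) \<le> ln (real n) * real n powr (- x) + real n powr (- x)"
        by (simp add: M_def a_def abs_mult distrib_right)
    qed
    show "summable (\<lambda>n. ln (real n) * real n powr (- x) + real n powr (- x))"
      using x by (intro summable_add summable_ln_powr) (simp_all add: summable_real_powr_iff)
  qed
  have w: "\<bar>1 - t / L\<bar> \<le> 1" if "t \<in> {0..L}" for t
    using that L by (auto simp: abs_le_iff field_simps)
  have "uniform_limit {0..L} (\<lambda>n t. \<Sum>i<n. f i t) (\<lambda>t. \<Sum>i. f i t) sequentially"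
  proof (rule Weierstrass_m_test[OF _ M])
    fix n t assume t: "t \<in> {0..L}"
    have "\<bar>1 - t / L\<bar> * \<bar>cos (t * (ln (real n) - y))\<bar> \<le> 1 * 1"
      using w[OF t] by (intro mult_mono) auto
    hence "\<bar>a n\<bar> * (\<bar>1 - t / L\<bar> * \<bar>cos (t * (ln (real n) - y))\<bar>) \<le> \<bar>a n\<bar> * 1"
      by (intro mult_left_mono) auto
    thus "norm (f n t) \<le> M n" by (simp add: f_def M_def abs_mult)
  qed
  moreover have "(\<Sum>i. f i t) = (1 - t / L) * Re (cis (t * y) * F (Complex x t))" for t
  proof -
    have "(\<lambda>n. Re (cis (t * y) * (of_real (prime_ln n - 1) * inv_pow n (Complex x t)))) sums
        Re (cis (t * y) * F (Complex x t))"
      using x by (intro sums_Re sums_mult Fs) simp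
    hence "(\<lambda>n. (1 - t / L) * Re (cis (t * y) * (of_real (prime_ln n - 1) * inv_pow n (Complex x t)))) sums
        ((1 - t / L) * Re (cis (t * y) * F (Complex x t)))"
      by (rule sums_mult)
    moreover have "(1 - t / L) * Re (cis (t * y) * (of_real (prime_ln n - 1) * inv_pow n (Complex x t))) = f n t" for n
    proof (cases "n = 0")
      case False
      have Ln: "Ln (of_nat n) = of_real (ln (real n))" using False by (simp flip: Ln_of_nat)
      have "inv_pow n (Complex x t) = of_real (real n powr (- x)) * cis (- (t * ln (real n)))"
        using False by (simp add: powr_def Ln exp_eq_polar[of "- (Complex x t * of_real (ln (real n)))"] mult.commute)
      hence "cis (t * y) * (of_real (prime_ln n - 1) * inv_pow n (Complex x t)) =
          of_real (a n) * (cis (t * y) * cis (- (t * ln (real n))))"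
        by (simp add: a_def)
      also have "cis (t * y) * cis (- (t * ln (real n))) = cis (- (t * (ln (real n) - y)))"
        by (simp add: cis_mult algebra_simps)
      also have "Re (of_real (a n) * \<dots>) = a n * cos (t * (ln (real n) - y))"
        by (simp only: Re_of_real_mult cis.sel(1) cos_minus)
      finally show ?thesis by (simp only: f_def mult.left_commute)
    qed (simp add: f_def a_def)
    ultimately show ?thesis by (simp add: sums_iff)
  qed
  ultimately have U: "uniform_limit {0..L} (\<lambda>n t. \<Sum>i<n. f i t)
      (\<lambda>t. (1 - t / L) * Re (cis (t * y) * F (Complex x t))) sequentially" by simp
  have cf: "continuous_on {0..L} (f n)" for n
    unfolding f_def using L by (intro continuous_intros) auto
  have csum: "continuous_on {0..L} (\<lambda>t. \<Sum>i<n. f i t)" for n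
    by (intro continuous_on_sum cf)
  obtain I J where IJ: "\<And>n. ((\<lambda>t. \<Sum>i<n. f i t) has_integral I n) {0..L}"
      "((\<lambda>t. (1 - t / L) * Re (cis (t * y) * F (Complex x t))) has_integral J) {0..L}"
      "I \<longlonglongrightarrow> J"
    by (rule uniform_limit_integral[OF U csum trivial_limit_sequentially]) blast
  have In: "I n = (\<Sum>i<n. a i * fejer L (ln (real i) - y))" for n
  proof (rule has_integral_unique[OF IJ(1)])
    have "((\<lambda>t. f i t) has_integral a i * fejer L (ln (real i) - y)) {0..L}" for i
      unfolding f_def fejer_def using L
      by (intro has_integral_mult_right integrable_integral fejer_integrable) simp
    thus "((\<lambda>t. \<Sum>i<n. f i t) has_integral (\<Sum>i<n. a i * fejer L (ln (real i) - y))) {0..L}"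
      by (intro has_integral_sum) auto
  qed
  have "(\<lambda>n. a n * fejer L (ln (real n) - y)) sums J"
    using IJ(3) unfolding sums_def In [symmetric] .
  thus ?thesis using IJ(2) by (simp add: a_def integral_unique)
qed

text \<open>Between \<open>exp y\<close> and \<open>exp (y + 1 / L)\<close> there are at least \<open>exp y / L - 1\<close> integers, and each of them is at most
  \<open>exp (y + 1)\<close>.\<close>
lemma sum_recip_ge:
  assumes L: "L \<ge> 1" and y: "exp (- y) \<le> 1 / (2 * L)"
  shows "finite {n. n > 0 \<and> \<bar>ln (real n) - y\<bar> \<le> 1 / L}"
    and "(\<Sum>n | n > 0 \<and> \<bar>ln (real n) - y\<bar> \<le> 1 / L. real n powr (- 1)) \<ge> exp (- 1) / (2 * L)"
proof -
  define W where "W = {n. n > 0 \<and> \<bar>ln (real n) - y\<bar> \<le> 1 / L}"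
  have L0: "L > 0" using L by simp
  have le: "real n \<le> exp (y + 1 / L)" if "n \<in> W" for n
  proof -
    have "ln (real n) \<le> y + 1 / L" "n > 0" using that by (auto simp: W_def)
    thus ?thesis by (metis exp_le_cancel_iff exp_ln of_nat_0_less_iff)
  qed
  show fin: "finite {n. n > 0 \<and> \<bar>ln (real n) - y\<bar> \<le> 1 / L}"
    unfolding W_def [symmetric] by (rule finite_subset[of _ "{..nat \<lceil>exp (y + 1 / L)\<rceil>}"]) (auto dest!: le, linarith)
  define V where "V = {nat \<lceil>exp y\<rceil>..nat \<lfloor>exp (y + 1 / L)\<rfloor>}"
  have VW: "V \<subseteq> W"
  proof
    fix n assume n: "n \<in> V"
    have "exp y \<le> real n" using n unfolding V_def by (simp add: le_nat_iff nat_le_iff ceiling_le_iff)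
    moreover have "real n \<le> exp (y + 1 / L)" using n unfolding V_def by (simp add: le_nat_iff le_floor_iff)
    moreover have n0: "real n > 0" using \<open>exp y \<le> real n\<close> exp_gt_zero[of y] by linarith
    ultimately have "y \<le> ln (real n)" "ln (real n) \<le> y + 1 / L"
      using ln_le_cancel_iff[of "real n" "exp (y + 1 / L)"] by (simp_all add: ln_ge_iff)
    thus "n \<in> W" using n0 L0 by (auto simp: W_def abs_le_iff)
  qed
  have "exp y * (1 + 1 / L) \<le> exp y * exp (1 / L)"
    by (intro mult_left_mono exp_ge_add_one_self) auto
  hence ex: "exp (y + 1 / L) \<ge> exp y + exp y / L" by (simp add: exp_add ring_distribs)
  have cardV: "real (card V) \<ge> exp y / L - 1"
  proof -
    have "real (nat \<lceil>exp y\<rceil>) \<le> exp y + 1" by (simp add: of_nat_nat)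
    moreover have "real (nat \<lfloor>exp (y + 1 / L)\<rfloor>) \<ge> exp (y + 1 / L) - 1" by (simp add: of_nat_nat)
    moreover have "real (card V) \<ge> real (nat \<lfloor>exp (y + 1 / L)\<rfloor>) + 1 - real (nat \<lceil>exp y\<rceil>)"
      unfolding V_def card_atLeastAtMost by linarith
    ultimately show ?thesis using ex by linarith
  qed
  have "exp (- 1) / (2 * L) = exp (- 1) * (1 / L - 1 / (2 * L))" using L0 by (simp add: field_simps)
  also have "\<dots> \<le> exp (- 1) * (1 / L - exp (- y))" using y by (intro mult_left_mono) auto
  also have "\<dots> = (exp y / L - 1) * exp (- y - 1)"
    by (simp add: exp_diff exp_minus field_simps)
  also have "\<dots> \<le> real (card V) * exp (- y - 1)" using cardV by (intro mult_right_mono) auto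
  also have "\<dots> = (\<Sum>n\<in>V. exp (- y - 1))" by simp
  also have "\<dots> \<le> (\<Sum>n\<in>V. real n powr (- 1))"
  proof (rule sum_mono)
    fix n assume "n \<in> V"
    hence n: "n \<in> W" using VW by auto
    hence n0: "n > 0" by (auto simp: W_def)
    have "1 / L \<le> 1" using L by simp
    hence "ln (real n) \<le> y + 1" using n by (auto simp: W_def abs_le_iff)
    hence "exp (- (y + 1)) \<le> exp (- ln (real n))" by simp
    thus "exp (- y - 1) \<le> real n powr (- 1)" using n0 by (simp add: powr_def)
  qed
  also have "\<dots> \<le> (\<Sum>n\<in>W. real n powr (- 1))"
    using fin VW by (intro sum_mono2) (auto simp: W_def)
  finally show "(\<Sum>n | n > 0 \<and> \<bar>ln (real n) - y\<bar> \<le> 1 / L. real n powr (- 1)) \<ge> exp (- 1) / (2 * L)"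
    by (simp add: W_def)
qed

lemma sums_eventually_le:
  fixes f :: "nat \<Rightarrow> real"
  assumes "f sums s" "\<forall>\<^sub>F N in sequentially. (\<Sum>n<N. f n) \<le> B"
  shows "s \<le> B"
  using assms unfolding sums_def by (intro tendsto_upperbound) auto

text \<open>Without primes in the window, the kernel sees primes only where it is at most \<open>2 / (L * e\<^sup>2)\<close>, and
  by the estimate with the Cauchy weight they contribute at most \<open>K / L\<close>, uniformly in \<open>x > 1\<close> and \<open>y\<close>. The coefficients
  \<open>-1\<close> at the integers with \<open>\<bar>ln n - y\<bar> \<le> 1 / L\<close> contribute at most \<open>- exp (- 1) / 8\<close> in the limit \<open>x = 1\<close>, and
  their sum with the contribution of the primes must tend to \<open>0\<close> by the Riemann-Lebesgue lemma.\<close>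
lemma primes_log_dense:
  assumes e: "0 < e"
  shows "\<forall>\<^sub>F y in at_top. \<exists>p. prime p \<and> \<bar>ln (real p) - y\<bar> < e"
proof -
  obtain F where F: "continuous_on {s. Re s \<ge> 1} F"
    and Fs: "\<And>s. Re s > 1 \<Longrightarrow> (\<lambda>n. of_real (prime_ln n - 1) * inv_pow n s) sums F s"
    using prime_series_boundary by blast
  define K where "K = 2 * (1 + 1 / e\<^sup>2) * (ln 8 * (1 + pi))"
  have K: "K > 0" unfolding K_def using e pi_gt_zero by (intro mult_pos_pos add_pos_pos) auto
  \<comment> \<open>This size of \<open>L\<close> bounds the contribution \<open>K / L\<close> of the primes by half of \<open>exp (- 1) / 8\<close>.\<close>
  define L where "L = 1 + 16 * exp 1 * K"
  have L: "L \<ge> 1" "L > 0" using K by (auto simp: L_def intro: add_pos_pos)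
  have KL: "K / L \<le> exp (- 1) / 16"
  proof -
    have "K * 16 * exp 1 \<le> L" by (simp add: L_def)
    thus ?thesis using L by (simp add: exp_minus field_simps)
  qed
  define I where "I x y = integral {0..L} (\<lambda>t. (1 - t / L) * Re (cis (t * y) * F (Complex x t)))" for x y
  have cF: "continuous_on (T :: 'z :: topological_space set) (\<lambda>z. F (Complex (g z) (k z)))"
    if "continuous_on T g" "continuous_on T k" "\<And>z. z \<in> T \<Longrightarrow> g z \<ge> 1" for g k T
    by (rule continuous_on_compose2[OF F])
       (use that in \<open>auto intro!: continuous_intros simp: Complex_eq\<close>)
  have contI: "continuous_on {1..} (\<lambda>x. I x y)" for y
  proof -
    have "continuous_on {1..} (\<lambda>x. integral (cbox 0 L) (\<lambda>t. (1 - t / L) * Re (cis (t * y) * F (Complex x t))))"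
      using L by (intro integral_continuous_on_param)
        (auto simp: split_beta intro!: continuous_intros cF)
    thus ?thesis by (simp add: I_def)
  qed
  have "((\<lambda>y. Re (integral {0..L} (\<lambda>t. cis (t * y) * (of_real (1 - t / L) * F (Complex 1 t))))) \<longlongrightarrow> Re 0) at_top"
    using L by (intro tendsto_Re riemann_lebesgue continuous_intros cF) auto
  moreover have "Re (integral {0..L} (\<lambda>t. cis (t * y) * (of_real (1 - t / L) * F (Complex 1 t)))) = I 1 y" for y
  proof -
    have "(\<lambda>t. cis (t * y) * (of_real (1 - t / L) * F (Complex 1 t))) integrable_on {0..L}"
      using L by (intro integrable_continuous_real continuous_intros cF) auto
    hence "((\<lambda>t. Re (cis (t * y) * (of_real (1 - t / L) * F (Complex 1 t)))) has_integral
        Re (integral {0..L} (\<lambda>t. cis (t * y) * (of_real (1 - t / L) * F (Complex 1 t))))) {0..L}"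
      by (intro has_integral_Re integrable_integral)
    moreover have "Re (cis (t * y) * (of_real (1 - t / L) * F (Complex 1 t))) =
        (1 - t / L) * Re (cis (t * y) * F (Complex 1 t))" for t
      by (subst mult.left_commute) (simp only: Re_of_real_mult)
    ultimately show ?thesis unfolding I_def by (simp add: integral_unique)
  qed
  ultimately have "((\<lambda>y. I 1 y) \<longlongrightarrow> 0) at_top" by simp
  hence ev1: "\<forall>\<^sub>F y in at_top. I 1 y > - (exp (- 1) / 16)"
    by (rule order_tendstoD) simp
  have "((\<lambda>y::real. exp (- y)) \<longlongrightarrow> 0) at_top"
    by (rule filterlim_compose[OF exp_at_bot filterlim_uminus_at_bot_at_top])
  hence ev2: "\<forall>\<^sub>F y in at_top. exp (- y) < 1 / (2 * L)"
    by (rule order_tendstoD) (use L in simp)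
  show ?thesis using ev1 ev2
  proof eventually_elim
    case (elim y)
    show ?case
    proof (rule ccontr)
      assume no: "\<not> (\<exists>p. prime p \<and> \<bar>ln (real p) - y\<bar> < e)"
      define W where "W = {n. n > 0 \<and> \<bar>ln (real n) - y\<bar> \<le> 1 / L}"
      have W: "finite W" "(\<Sum>n\<in>W. real n powr (- 1)) \<ge> exp (- 1) / (2 * L)"
        using sum_recip_ge[OF L(1), of y] elim by (auto simp: W_def)
      have up: "prime_ln n * real n powr (- x) * fejer L (ln (real n) - y) \<le>
          2 * (1 + 1 / e\<^sup>2) / L * (prime_ln n * cauchy_weight y (real n))" if x: "x > 1" for n x
      proof (cases "prime n")
        case True
        hence n: "n \<ge> 2" by (rule prime_ge_2_nat)
        define u where "u = ln (real n) - y"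
        have u: "\<bar>u\<bar> \<ge> e" using no True by (metis not_less u_def)
        hence u0: "u \<noteq> 0" using e by auto
        have "e\<^sup>2 \<le> u\<^sup>2" using u e by (simp add: abs_le_square_iff[symmetric])
        hence "1 / u\<^sup>2 \<le> 1 / e\<^sup>2" using e u0 by (intro divide_left_mono) auto
        hence "1 / u\<^sup>2 \<le> (1 + 1 / e\<^sup>2) / (1 + u\<^sup>2)"
        proof -
          assume *: "1 / u\<^sup>2 \<le> 1 / e\<^sup>2"
          have "(1 + u\<^sup>2) / u\<^sup>2 = 1 + 1 / u\<^sup>2" using u0 by (simp add: field_simps)
          also have "\<dots> \<le> 1 + 1 / e\<^sup>2" using * by simp
          finally have "(1 + u\<^sup>2) * (1 / u\<^sup>2) \<le> 1 + 1 / e\<^sup>2" by simp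
          moreover have "1 + u\<^sup>2 > 0" by (simp add: add_pos_nonneg)
          ultimately show ?thesis by (simp only: pos_le_divide_eq mult.commute)
        qed
        hence "2 / L * (1 / u\<^sup>2) \<le> 2 / L * ((1 + 1 / e\<^sup>2) / (1 + u\<^sup>2))"
          using L by (intro mult_left_mono) auto
        hence fe: "fejer L u \<le> 2 / L * ((1 + 1 / e\<^sup>2) / (1 + u\<^sup>2))"
          using fejer_le[OF L(2) u0] by simp
        have "real n powr (- x) \<le> real n powr (- 1)" using n x by (intro powr_mono) auto
        hence "real n powr (- x) * fejer L u \<le> real n powr (- 1) * (2 / L * ((1 + 1 / e\<^sup>2) / (1 + u\<^sup>2)))"
          by (intro mult_mono fe fejer_nonneg L) auto
        also have "\<dots> = 2 * (1 + 1 / e\<^sup>2) / L * cauchy_weight y (real n)"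
          using n by (simp add: cauchy_weight_def u_def powr_minus_divide field_simps)
        finally have "prime_ln n * (real n powr (- x) * fejer L u) \<le>
            prime_ln n * (2 * (1 + 1 / e\<^sup>2) / L * cauchy_weight y (real n))"
          by (intro mult_left_mono prime_ln_nonneg)
        thus ?thesis by (simp add: u_def mult_ac)
      qed (simp add: prime_ln_def)
      have bound: "I x y \<le> K / L - L / 4 * (\<Sum>n\<in>W. real n powr (- x))" if x: "x > 1" for x
      proof (rule sums_eventually_le)
        show "(\<lambda>n. (prime_ln n - 1) * real n powr (- x) * fejer L (ln (real n) - y)) sums I x y"
          unfolding I_def by (rule fejer_sum[OF F Fs L(2) x])
        obtain N0 where N0: "W \<subseteq> {..<N0}" using W(1) finite_nat_iff_bounded by auto
        show "\<forall>\<^sub>F N in sequentially. (\<Sum>n<N. (prime_ln n - 1) * real n powr (- x) * fejer L (ln (real n) - y))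
            \<le> K / L - L / 4 * (\<Sum>n\<in>W. real n powr (- x))"
          using eventually_ge_at_top[of N0]
        proof eventually_elim
          case (elim N)
          have "(\<Sum>n<N. prime_ln n * real n powr (- x) * fejer L (ln (real n) - y)) \<le>
              (\<Sum>n<N. 2 * (1 + 1 / e\<^sup>2) / L * (prime_ln n * cauchy_weight y (real n)))"
            by (intro sum_mono up x)
          also have "\<dots> = 2 * (1 + 1 / e\<^sup>2) / L * (\<Sum>n<N. prime_ln n * cauchy_weight y (real n))"
            by (simp add: sum_distrib_left)
          also have "\<dots> \<le> 2 * (1 + 1 / e\<^sup>2) / L * (ln 8 * (1 + pi))"
            using L by (intro mult_left_mono sum_prime_ln_cauchy_weight_le) auto
          also have "\<dots> = K / L" by (simp add: K_def)
          finally have 1: "(\<Sum>n<N. prime_ln n * real n powr (- x) * fejer L (ln (real n) - y)) \<le> K / L" .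
          have "L / 4 * (\<Sum>n\<in>W. real n powr (- x)) = (\<Sum>n\<in>W. real n powr (- x) * (L / 4))"
            by (simp add: sum_distrib_left mult.commute)
          also have "\<dots> \<le> (\<Sum>n\<in>W. real n powr (- x) * fejer L (ln (real n) - y))"
            by (intro sum_mono mult_left_mono fejer_ge L) (auto simp: W_def)
          also have "\<dots> \<le> (\<Sum>n<N. real n powr (- x) * fejer L (ln (real n) - y))"
            using N0 elim L by (intro sum_mono2) (auto intro!: mult_nonneg_nonneg fejer_nonneg)
          finally have 2: "L / 4 * (\<Sum>n\<in>W. real n powr (- x)) \<le> \<dots>" .
          show ?case using 1 2 by (simp add: left_diff_distrib sum_subtractf)
        qed
      qed
      have "((\<lambda>x. I x y) \<longlongrightarrow> I 1 y) (at 1 within {1..})"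
        using contI[of y] by (simp add: continuous_on_def)
      hence lim1: "((\<lambda>x. I x y) \<longlongrightarrow> I 1 y) (at_right 1)"
        by (rule tendsto_within_subset) auto
      have lim2: "((\<lambda>x. K / L - L / 4 * (\<Sum>n\<in>W. real n powr (- x))) \<longlongrightarrow>
          K / L - L / 4 * (\<Sum>n\<in>W. real n powr (- 1))) (at_right 1)"
        by (intro tendsto_intros) (auto simp: W_def)
      have "I 1 y \<le> K / L - L / 4 * (\<Sum>n\<in>W. real n powr (- 1))"
      proof (rule tendsto_le[OF trivial_limit_at_right_real lim2 lim1])
        show "\<forall>\<^sub>F x in at_right 1. I x y \<le> K / L - L / 4 * (\<Sum>n\<in>W. real n powr (- x))"
          using bound by (rule eventually_mono[OF eventually_at_right_less])
      qed
      also have "\<dots> \<le> exp (- 1) / 16 - L / 4 * (exp (- 1) / (2 * L))"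
        using KL W(2) L by (intro diff_mono mult_left_mono) auto
      also have "\<dots> = - (exp (- 1) / 16)" using L by simp
      finally show False using elim by simp
    qed
  qed
qed

text \<open>The logarithmic window of radius \<open>e / 2\<close> around \<open>ln x - e / 2\<close> has the end points \<open>ln x - e\<close> and \<open>ln x\<close>,
  and \<open>exp (- e) \<ge> 1 - e\<close>.\<close>
lemma primes_dense:
  assumes e: "0 < e"
  shows "\<forall>\<^sub>F x in at_top. \<exists>p. prime p \<and> (1 - e) * x \<le> real p \<and> real p \<le> x"
proof -
  have "filterlim (\<lambda>x::real. ln x - e / 2) at_top at_top"
    using filterlim_tendsto_add_at_top[OF tendsto_const[of "- e / 2"] ln_at_top] by simp
  hence "\<forall>\<^sub>F x::real in at_top. \<exists>p. prime p \<and> \<bar>ln (real p) - (ln x - e / 2)\<bar> < e / 2"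
    using eventually_compose_filterlim[OF primes_log_dense[of "e / 2"]] e by simp
  thus ?thesis using eventually_gt_at_top[of 0]
  proof eventually_elim
    case (elim x)
    then obtain p where p: "prime p" "\<bar>ln (real p) - (ln x - e / 2)\<bar> < e / 2" by blast
    have p0: "real p > 0" using p(1) prime_gt_0_nat by simp
    have "ln (real p) \<le> ln x" "ln x - e \<le> ln (real p)" using p(2) by (simp_all only: abs_less_iff) linarith+
    hence "real p \<le> x" "exp (ln x - e) \<le> real p"
      using p0 elim by (simp, metis exp_le_cancel_iff exp_ln)
    moreover have "(1 - e) * x \<le> exp (ln x - e)"
    proof -
      have "(1 - e) * x \<le> exp (- e) * x"
        using elim exp_ge_add_one_self[of "- e"] by (intro mult_right_mono) auto
      also have "\<dots> = exp (ln x - e)" using elim by (simp add: exp_diff exp_minus field_simps)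
      finally show ?thesis .
    qed
    ultimately show ?case using p(1) by (intro exI[of _ p]) auto
  qed
qed

section \<open>The asymptotic lower bound\<close>

theorem mainTheorem11:
  shows "\<exists>e :: nat \<Rightarrow> real. e \<in> o(\<lambda>n. real n ^ 2) \<and>
           (\<forall>n\<ge>2. real (h n) \<ge> 1 / 2 * real n ^ 2 - e n)"
proof (intro exI conjI)
  define e where "e n = max 0 (1 / 2 * real n ^ 2 - real (h n))" for n
  show "\<forall>n\<ge>2. real (h n) \<ge> 1 / 2 * real n ^ 2 - e n" by (auto simp: e_def)
  show "e \<in> o(\<lambda>n. real n ^ 2)"
  proof (rule landau_o.smallI)
    fix c :: real assume c: "c > 0"
    \<comment> \<open>The prime \<open>p\<close> is taken between \<open>(1 - d)\<^sup>2 * n\<close> and \<open>(1 - d) * n\<close>, which leaves \<open>d * n\<close>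
      for \<open>2 * r\<close> and loses at most \<open>3 * d * n\<^sup>2\<close>.\<close>
    define d where "d = min (c / 3) (1 / 4)"
    have d: "0 < d" "3 * d \<le> c" "d \<le> 1 / 4" using c by (auto simp: d_def)
    have P: "\<forall>\<^sub>F n::nat in sequentially. \<exists>p. prime p \<and> (1 - u) * (a * real n) \<le> real p \<and> real p \<le> a * real n"
      if "a > 0" "u > 0" for a u
      using eventually_compose_filterlim[OF primes_dense[OF that(2)],
        OF filterlim_tendsto_pos_mult_at_top[OF tendsto_const[of a] that(1) filterlim_real_sequentially]] .
    have P1: "\<forall>\<^sub>F n::nat in sequentially. \<exists>p. prime p \<and>
        (1 - d) * ((1 - d) * real n) \<le> real p \<and> real p \<le> (1 - d) * real n"
      and P2: "\<forall>\<^sub>F n::nat in sequentially. \<exists>p. prime p \<and>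
        (1 - 1 / 2) * (d / 2 * real n) \<le> real p \<and> real p \<le> d / 2 * real n"
      using d by (intro P; simp)+
    have "\<forall>\<^sub>F n::nat in sequentially. 1 / d \<le> real n \<and> 32 / d\<^sup>2 \<le> real n \<and> 16 / d \<le> real n"
      using filterlim_real_sequentially unfolding filterlim_at_top by (intro eventually_conj) auto
    thus "\<forall>\<^sub>F n in sequentially. norm (e n) \<le> c * norm (real n ^ 2)"
      using P1 P2
    proof eventually_elim
      case (elim n)
      then obtain p r where p: "prime p" "(1 - d) * ((1 - d) * real n) \<le> real p" "real p \<le> (1 - d) * real n"
        and r: "prime r" "(1 - 1 / 2) * (d / 2 * real n) \<le> real r" "real r \<le> d / 2 * real n"
        by auto
      have n: "1 \<le> d * real n" "32 \<le> d\<^sup>2 * real n" "16 \<le> d * real n"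
        using elim d by (auto simp: field_simps)
      have r4: "real r \<ge> 4" "real r \<ge> d / 4 * real n" using r(2) n by auto
      have pb: "real p - 1 \<ge> (1 - 3 * d) * real n" "real p > 2"
      proof -
        have "(1 - d) * ((1 - d) * real n) = (1 - 2 * d) * real n + d\<^sup>2 * real n"
          by (simp add: power2_eq_square algebra_simps)
        moreover have "d\<^sup>2 * real n \<ge> 0" by simp
        ultimately have *: "real p \<ge> (1 - 2 * d) * real n" using p(2) by linarith
        thus "real p - 1 \<ge> (1 - 3 * d) * real n" using n by (simp add: algebra_simps)
        have "(1 - 2 * d) * real n \<ge> (2 * d) * real n" using d by (intro mult_right_mono) auto
        thus "real p > 2" using * n by linarith
      qed
      have np: "p > 2" "r > 2" using pb(2) r4(1) by linarith+
      have nn: "p + 2 * r \<le> n"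
      proof -
        have "real p + 2 * real r \<le> real n" using p(3) r(3) by (simp add: algebra_simps)
        thus ?thesis by linarith
      qed
      have rr: "p - 1 \<le> r * (r - 1)"
      proof -
        have "real n \<le> d\<^sup>2 * real n * real n / 32" using n(2) mult_right_mono[OF n(2), of "real n"] by simp
        also have "\<dots> = (d / 4 * real n) * (d / 4 * real n) / 2" by (simp add: power2_eq_square)
        also have "\<dots> \<le> real r * real r / 2" using r4 d by (intro divide_right_mono mult_mono) auto
        also have "\<dots> = real r * (real r / 2)" by simp
        also have "\<dots> \<le> real r * (real r - 1)" using r4 by (intro mult_left_mono) auto
        also have "\<dots> = real (r * (r - 1))" using np by (simp add: of_nat_diff)
        finally have "n \<le> r * (r - 1)" by linarith
        thus ?thesis using nn by linarith
      qed
      have "(p - 1) div 2 * p \<le> h n" by (rule h_ge_primes[OF p(1) np(1) r(1) np(2) rr nn])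
      moreover have "2 * ((p - 1) div 2 * p) = (p - 1) * p"
      proof -
        have "even (p - 1)" using prime_odd_nat[OF p(1) np(1)] by simp
        thus ?thesis by (metis dvd_mult_div_cancel mult.assoc)
      qed
      ultimately have "(p - 1) * p \<le> 2 * h n" by linarith
      hence "real ((p - 1) * p) \<le> real (2 * h n)" by (rule of_nat_mono)
      hence "(real p - 1) * real p \<le> 2 * real (h n)" using np by (simp add: of_nat_diff)
      moreover have "((1 - 3 * d) * real n) * ((1 - 3 * d) * real n) \<le> (real p - 1) * real p"
        using pb d by (intro mult_mono) auto
      moreover have "((1 - 3 * d) * real n) * ((1 - 3 * d) * real n) =
          real n ^ 2 - 6 * (d * real n ^ 2) + 9 * (d\<^sup>2 * real n ^ 2)"
        by (simp add: power2_eq_square algebra_simps)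
      moreover have "9 * (d\<^sup>2 * real n ^ 2) \<ge> 0" by simp
      ultimately have "1 / 2 * real n ^ 2 - real (h n) \<le> 3 * d * real n ^ 2" by linarith
      also have "\<dots> \<le> c * real n ^ 2" using d by (intro mult_right_mono) auto
      finally have "1 / 2 * real n ^ 2 - real (h n) \<le> c * real n ^ 2" .
      thus ?case using c by (simp add: e_def)
    qed
  qed
qed

end
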